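(* Let $L/K$ be a G-extension (equivalently, a finite Galois field extension), let $G=G(L/K)$ and $E=\mathrm{End}_K(L)$. Then: (1) $\mathcal{A}(E,L,G)=\{\,C_E(\Gamma)=L\rtimes G(L/\Gamma)\mid \Gamma\in\mathcal{G}(L/K)\,\}=\{\,L\rtimes N\mid N\in\mathcal{N}(G)\,\}$ (where in particular $C_E(\Gamma)=L\rtimes G(L/\Gamma)$ for each $\Gamma\in\mathcal G(L/K)$), and $\mathcal{N}(G)=\{\,G(L/\Gamma)\mid\Gamma\in\mathcal{G}(L/K)\,\}$. (2) The map $\mathcal{G}(L/K)\to\mathcal{A}(E,L,G)$, $\Gamma\mapsto C_E(\Gamma)=L\rtimes G(L/\Gamma)$, is a bijection with inverse $A\mapsto C_E(A)=L^{A\cap G}$. (3) (The Galois Correspondence for Galois subfields) The map $\mathcal{G}(L/K)\to\mathcal{N}(G)$, $\Gamma\mapsto G(L/\Gamma)=G^{\Gamma}$, is a bijection with inverse $N\mapsto L^{N}$.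
   Context: For a finite field extension $L/K$: $G=G(L/K)$ is the group of $K$-algebra automorphisms of $L$; $E=E(L/K)=\mathrm{End}_K(L)$ is the algebra of $K$-linear endomorphisms of $L$. The group $G$ is a subset of $E$, and $L$ is regarded as a $K$-subalgebra of $E$ by letting $l\in L$ act on $L$ by multiplication. $\mathcal{G}(L/K)$ is the set of all Galois subfields of $L/K$, i.e. intermediate fields $K\subseteq\Gamma\subseteq L$ such that $\Gamma/K$ is a Galois field extension; $\mathcal{N}(G)$ is the set of all normal subgroups of $G$; $\mathcal{A}(E,L,G)$ is the set of all $K$-subalgebras $A$ of $E$ that contain $L$ and satisfy $gAg^{-1}\subseteq A$ for all $g\in G$. For a subset $S\subseteq E$, $C_E(S)=\{a\in E\mid as=sa\text{ for all }s\in S\}$ is its centralizer. For a subgroup $H\le G$, $L\rtimes H$ denotes the $K$-subalgebra of $E$ generated by $L$ and $H$, i.e. $L\rtimes H=\sum_{h\in H}Lh$ (this sum is direct, and the multiplication is $\lambda g\cdot\mu h=\lambda g(\mu)gh$ for $\lambda,\mu\in L$, $g,h\in H$). The extension $L/K$ is called a G-extension if it is finite and $E=L\rtimes G$. For an intermediate field $\Gamma$, $G(L/\Gamma)$ is the group of $\Gamma$-algebra automorphisms of $L$ and $G^\Gamma=\{g\in G\mid g(\gamma)=\gamma\text{ for all }\gamma\in\Gamma\}$. For a subgroup $H\le G$, $L^H=\{l\in L\mid h(l)=l\text{ for all }h\in H\}$. For a $K$-subalgebra $A$ of $E$ containing $L$, $L^{A\cap G}=\{l\in L\mid g(l)=l\text{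 for all }g\in A\cap G\}$, where $A\cap G$ is taken inside $E$. *)

theory Defs
  imports "HOL-Algebra.Bij" "HOL-Algebra.Algebraic_Closure"
begin

section \<open>Field extensions\<close>

text \<open>
  A field extension \<open>L/K\<close> is a field \<open>L\<close> together with a subfield \<open>K\<close> of it, given as a
  subset of the carrier.  An intermediate field \<open>\<Gamma>\<close> is likewise a subset of the carrier, and
  \<open>\<Gamma>/K\<close> is the extension \<open>L\<lparr>carrier := \<Gamma>\<rparr>\<close> of \<open>K\<close>.
\<close>

definition algebraic_extension :: "('a, 'b) ring_scheme \<Rightarrow> 'a set \<Rightarrow> bool" where
  "algebraic_extension L K \<longleftrightarrow> (\<forall>x \<in> carrier L. ring.algebraic L K x)"

definition normal_extension :: "('a, 'b) ring_scheme \<Rightarrow> 'a set \<Rightarrow> bool" where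
  "normal_extension L K \<longleftrightarrow>
     algebraic_extension L K \<and>
     (\<forall>p \<in> carrier (K[X]\<^bsub>L\<^esub>).
        pirreducible\<^bsub>L\<^esub> K p \<and> (\<exists>x. ring.is_root L p x) \<longrightarrow> ring.splitted L p)"

text \<open>
  Separability: the minimal polynomial over \<open>K\<close> of each element of \<open>L\<close> has only simple roots
  in an algebraic closure of \<open>L\<close>.  The map \<open>indexed_const\<close> is the embedding of \<open>L\<close> into the
  library's algebraic closure of \<open>L\<close>.
\<close>

definition separable_extension :: "('a, 'b) ring_scheme \<Rightarrow> 'a set \<Rightarrow> bool" where
  "separable_extension L K \<longleftrightarrow>
     algebraic_extension L K \<and>
     (\<forall>x \<in> carrier L. \<forall>z \<in> carrier (field.alg_closure L).
        ring.alg_mult (field.alg_closure L) (map (ring.indexed_const L) (ring.Irr L K x)) z \<le> 1)"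

definition galois_extension :: "('a, 'b) ring_scheme \<Rightarrow> 'a set \<Rightarrow> bool" where
  "galois_extension L K \<longleftrightarrow>
     field L \<and> subfield K L \<and> normal_extension L K \<and> separable_extension L K"

definition galois_subfields :: "('a, 'b) ring_scheme \<Rightarrow> 'a set \<Rightarrow> 'a set set" where
  "galois_subfields L K =
     {\<Gamma>. subfield \<Gamma> L \<and> K \<subseteq> \<Gamma> \<and> galois_extension (L\<lparr>carrier := \<Gamma>\<rparr>) K}"


section \<open>The automorphism group\<close>

text \<open>
  As in \<^theory>\<open>HOL-Algebra.Bij\<close>, maps \<open>L \<rightarrow> L\<close> are represented by functions that are
  extensional on the carrier.
\<close>

definition Gal :: "('a, 'b) ring_scheme \<Rightarrow> 'a set \<Rightarrow> ('a \<Rightarrow> 'a) set" where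
  "Gal L K = {g \<in> ring_iso L L \<inter> extensional (carrier L). \<forall>k \<in> K. g k = k}"

definition Gal_group :: "('a, 'b) ring_scheme \<Rightarrow> 'a set \<Rightarrow> ('a \<Rightarrow> 'a) monoid" where
  "Gal_group L K = BijGroup (carrier L) \<lparr>carrier := Gal L K\<rparr>"

definition normal_subgroups :: "('g, 'm) monoid_scheme \<Rightarrow> 'g set set" where
  "normal_subgroups G = {N. N \<lhd> G}"

definition fixed_field :: "('a, 'b) ring_scheme \<Rightarrow> ('a \<Rightarrow> 'a) set \<Rightarrow> 'a set" where
  "fixed_field L H = {l \<in> carrier L. \<forall>h \<in> H. h l = l}"

definition pointwise_stabilizer :: "('a \<Rightarrow> 'a) set \<Rightarrow> 'a set \<Rightarrow> ('a \<Rightarrow> 'a) set" where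
  "pointwise_stabilizer G \<Gamma> = {g \<in> G. \<forall>\<gamma> \<in> \<Gamma>. g \<gamma> = \<gamma>}"


section \<open>The endomorphism algebra\<close>

definition End_alg :: "('a, 'b) ring_scheme \<Rightarrow> 'a set \<Rightarrow> ('a \<Rightarrow> 'a) ring" where
  "End_alg L K =
     \<lparr> carrier = {f \<in> carrier L \<rightarrow>\<^sub>E carrier L.
         (\<forall>x \<in> carrier L. \<forall>y \<in> carrier L. f (x \<oplus>\<^bsub>L\<^esub> y) = f x \<oplus>\<^bsub>L\<^esub> f y) \<and>
         (\<forall>k \<in> K. \<forall>x \<in> carrier L. f (k \<otimes>\<^bsub>L\<^esub> x) = k \<otimes>\<^bsub>L\<^esub> f x)},
       monoid.mult = compose (carrier L),
       one = (\<lambda>x \<in> carrier L. x),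
       zero = (\<lambda>x \<in> carrier L. \<zero>\<^bsub>L\<^esub>),
       add = (\<lambda>f g. \<lambda>x \<in> carrier L. f x \<oplus>\<^bsub>L\<^esub> g x) \<rparr>"

text \<open>Elements of \<open>L\<close>, and in particular of \<open>K\<close>, are regarded as elements of \<open>E\<close> via \<open>lmult\<close>.\<close>

definition lmult :: "('a, 'b) ring_scheme \<Rightarrow> 'a \<Rightarrow> ('a \<Rightarrow> 'a)" where
  "lmult L l = (\<lambda>x \<in> carrier L. l \<otimes>\<^bsub>L\<^esub> x)"

definition centralizer :: "('r, 'm) monoid_scheme \<Rightarrow> 'r set \<Rightarrow> 'r set" where
  "centralizer R S = {a \<in> carrier R. \<forall>s \<in> S. a \<otimes>\<^bsub>R\<^esub> s = s \<otimes>\<^bsub>R\<^esub> a}"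

text \<open>
  The library predicate \<open>subalgebra\<close> only asks for closure under addition and scalars; closure
  under multiplication and the unit come from \<open>subring\<close>.
\<close>

definition is_subalgebra :: "('a, 'b) ring_scheme \<Rightarrow> 'a set \<Rightarrow> ('a \<Rightarrow> 'a) set \<Rightarrow> bool" where
  "is_subalgebra L K A \<longleftrightarrow>
     subring A (End_alg L K) \<and> subalgebra (lmult L ` K) A (End_alg L K)"

definition invariant_subalgebras :: "('a, 'b) ring_scheme \<Rightarrow> 'a set \<Rightarrow> ('a \<Rightarrow> 'a) set set" where
  "invariant_subalgebras L K =
     {A. is_subalgebra L K A \<and> lmult L ` carrier L \<subseteq> A \<and>
         (\<forall>g \<in> Gal L K.
            (\<lambda>a. g \<otimes>\<^bsub>End_alg L K\<^esub> a \<otimes>\<^bsub>End_alg L K\<^esub> inv\<^bsub>End_alg L K\<^esub> g) ` A \<subseteq> A)}"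

text \<open>\<open>L \<rtimes> H\<close>: the \<open>K\<close>-subalgebra of \<open>E\<close> generated by \<open>L\<close> and \<open>H\<close>, for \<open>H \<subseteq> E\<close>.\<close>

definition skew :: "('a, 'b) ring_scheme \<Rightarrow> 'a set \<Rightarrow> ('a \<Rightarrow> 'a) set \<Rightarrow> ('a \<Rightarrow> 'a) set" where
  "skew L K H = \<Inter>{A. is_subalgebra L K A \<and> lmult L ` carrier L \<subseteq> A \<and> H \<subseteq> A}"

definition G_extension :: "('a, 'b) ring_scheme \<Rightarrow> 'a set \<Rightarrow> bool" where
  "G_extension L K \<longleftrightarrow>
     field L \<and> subfield K L \<and> ring.finite_dimension L K (carrier L) \<and>
     carrier (End_alg L K) = skew L K (Gal L K)"

end

theory Submission
  imports Defs
begin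

text \<open>
  Let \<open>E = End\<^sub>K(L)\<close>, generated as an algebra by \<open>L\<close> and \<open>G\<close>.  Everything rests on the way
  the automorphisms sit in \<open>E\<close>: they are isolated from each other by the action of \<open>L\<close> on both
  sides.  If \<open>A\<close> is an additive subgroup of \<open>E\<close>, stable under multiplication by \<open>L\<close> on the left
  and on the right, and a sum \<open>\<Sum> l\<^sub>g g\<close> lies in \<open>A\<close>, then every \<open>g\<close> with \<open>l\<^sub>g \<noteq> 0\<close> lies in \<open>A\<close>
  (\<open>automorphism_in_bimodule\<close>, by the shortest-relation argument of Dedekind).  For \<open>A = 0\<close> this is
  the independence of automorphisms; for a subalgebra \<open>A\<close> containing \<open>L\<close> it says that
  \<open>A = L \<rtimes> (A \<inter> G)\<close> (\<open>subalgebra_eq_skew\<close>).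

  Subalgebras containing \<open>L\<close> are thus governed by the subgroups \<open>A \<inter> G\<close>.  For an intermediate
  field \<open>\<Gamma>\<close> the centralizer \<open>C\<^sub>E(\<Gamma>)\<close> is such a subalgebra, and it meets \<open>G\<close> in \<open>G(L/\<Gamma>)\<close>, whence
  \<open>C\<^sub>E(\<Gamma>) = L \<rtimes> G(L/\<Gamma>)\<close>.  Two facts close the circle.  A subgroup \<open>H\<close> is recovered from its fixed
  field (\<open>Gal_fixed_field\<close>): if \<open>g\<close> fixes \<open>L\<^sup>H\<close> pointwise, then \<open>g\<close> does not change the trace
  \<open>\<Sum>\<^sub>h h\<close>, whose values lie in \<open>L\<^sup>H\<close>, and by independence \<open>gH = H\<close>.  An intermediate field is
  recovered from its group (\<open>fixed_field_Gal\<close>): an element fixed by \<open>G(L/\<Gamma>)\<close> commutes with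
  \<open>C\<^sub>E(\<Gamma>) = End\<^sub>\<Gamma>(L)\<close>, in particular with a \<open>\<Gamma>\<close>-linear projection of \<open>L\<close> onto \<open>\<Gamma>\<close>, and therefore
  belongs to \<open>\<Gamma>\<close>.

  Invariance of \<open>A\<close> under conjugation by \<open>G\<close> makes \<open>A \<inter> G\<close> normal, and normality of a subgroup
  makes its fixed field \<open>G\<close>-stable.  What remains is that the \<open>G\<close>-stable intermediate fields are
  exactly the Galois subfields.  If \<open>\<Gamma>\<close> is stable and \<open>x \<in> \<Gamma>\<close>, the polynomial with the orbit of \<open>x\<close>
  as its set of simple roots has coefficients in \<open>L\<^sup>G = K\<close>, which bounds the degree of any irreducible
  polynomial over \<open>K\<close> with root \<open>x\<close> by the number of conjugates of \<open>x\<close>; so such a polynomial has all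
  its roots in \<open>\<Gamma>\<close>, and all are simple (\<open>stable_imp_galois\<close>).  Conversely, if \<open>\<Gamma>\<close> is Galois over \<open>K\<close>,
  the minimal polynomial of \<open>x \<in> \<Gamma>\<close> splits over \<open>\<Gamma>\<close> and a conjugate of \<open>x\<close> must be one of its roots
  in \<open>\<Gamma>\<close> (\<open>galois_imp_stable\<close>).
\<close>

section \<open>The endomorphism algebra\<close>

locale finite_field_extension = field L for L :: "('a, 'b) ring_scheme" (structure) +
  fixes K :: "'a set"
  assumes subfield_K: "subfield K L"
    and finite_dim: "finite_dimension K (carrier L)"
begin

abbreviation E where "E \<equiv> End_alg L K"
abbreviation G where "G \<equiv> Gal L K"

lemma K_closed [simp]: "k \<in> K \<Longrightarrow> k \<in> carrier L"
  using subfieldE(3)[OF subfield_K] by auto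

lemma E_carrier: "f \<in> carrier E \<longleftrightarrow> f \<in> carrier L \<rightarrow>\<^sub>E carrier L \<and>
    (\<forall>x \<in> carrier L. \<forall>y \<in> carrier L. f (x \<oplus> y) = f x \<oplus> f y) \<and>
    (\<forall>k \<in> K. \<forall>x \<in> carrier L. f (k \<otimes> x) = k \<otimes> f x)"
  by (simp add: End_alg_def)

text \<open>
  These rules are applied with a concrete endomorphism in place of \<open>f\<close>: as rewrite rules with a
  variable head \<open>f\<close> they would match every term.
\<close>

lemma E_app: "f \<in> carrier E \<Longrightarrow> x \<in> carrier L \<Longrightarrow> f x \<in> carrier L"
  by (auto simp: E_carrier)

lemma E_add: "f \<in> carrier E \<Longrightarrow> x \<in> carrier L \<Longrightarrow> y \<in> carrier L \<Longrightarrow> f (x \<oplus> y) = f x \<oplus> f y"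
  by (simp add: E_carrier)

lemma E_smult: "f \<in> carrier E \<Longrightarrow> k \<in> K \<Longrightarrow> x \<in> carrier L \<Longrightarrow> f (k \<otimes> x) = k \<otimes> f x"
  by (simp add: E_carrier)

lemma E_eqI:
  assumes "f \<in> carrier E" "g \<in> carrier E" "\<And>x. x \<in> carrier L \<Longrightarrow> f x = g x"
  shows "f = g"
  using assms by (intro extensionalityI[of f "carrier L"]) (auto simp: E_carrier PiE_def)

lemma E_ops:
  "x \<in> carrier L \<Longrightarrow> (f \<otimes>\<^bsub>E\<^esub> g) x = f (g x)"
  "x \<in> carrier L \<Longrightarrow> (f \<oplus>\<^bsub>E\<^esub> g) x = f x \<oplus> g x"
  "x \<in> carrier L \<Longrightarrow> \<one>\<^bsub>E\<^esub> x = x"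
  "x \<in> carrier L \<Longrightarrow> \<zero>\<^bsub>E\<^esub> x = \<zero>"
  by (simp_all add: End_alg_def compose_def)

lemma E_I:
  assumes "f \<in> extensional (carrier L)"
    and "\<And>x. x \<in> carrier L \<Longrightarrow> f x \<in> carrier L"
    and "\<And>x y. x \<in> carrier L \<Longrightarrow> y \<in> carrier L \<Longrightarrow> f (x \<oplus> y) = f x \<oplus> f y"
    and "\<And>k x. k \<in> K \<Longrightarrow> x \<in> carrier L \<Longrightarrow> f (k \<otimes> x) = k \<otimes> f x"
  shows "f \<in> carrier E"
  using assms by (simp add: E_carrier PiE_def)

lemma E_mult_closed:
  assumes f: "f \<in> carrier E" and g: "g \<in> carrier E"
  shows "f \<otimes>\<^bsub>E\<^esub> g \<in> carrier E"
  by (rule E_I) (simp_all add: End_alg_def compose_def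
      E_app[OF f] E_app[OF g] E_add[OF f] E_add[OF g] E_smult[OF f] E_smult[OF g])

lemma E_add_closed:
  assumes f: "f \<in> carrier E" and g: "g \<in> carrier E"
  shows "f \<oplus>\<^bsub>E\<^esub> g \<in> carrier E"
  by (rule E_I) (simp_all add: End_alg_def a_ac r_distr
      E_app[OF f] E_app[OF g] E_add[OF f] E_add[OF g] E_smult[OF f] E_smult[OF g])

lemma E_one_closed: "\<one>\<^bsub>E\<^esub> \<in> carrier E"
  by (rule E_I) (simp_all add: End_alg_def)

lemma E_zero_closed: "\<zero>\<^bsub>E\<^esub> \<in> carrier E"
  by (rule E_I) (simp_all add: End_alg_def)

lemmas E_closed = E_mult_closed E_add_closed E_one_closed E_zero_closed

lemma E_neg:
  assumes f: "f \<in> carrier E"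
  shows "(\<lambda>x \<in> carrier L. \<ominus> f x) \<in> carrier E"
  by (rule E_I) (simp_all add: E_app[OF f] E_add[OF f] E_smult[OF f] minus_add r_minus)

lemma ring_E: "ring E"
proof (rule ringI)
  show "abelian_group E"
  proof (rule abelian_groupI)
    fix f assume f: "f \<in> carrier E"
    show "\<exists>g \<in> carrier E. g \<oplus>\<^bsub>E\<^esub> f = \<zero>\<^bsub>E\<^esub>"
      by (rule bexI[OF _ E_neg[OF f]], rule E_eqI)
        (simp_all add: f E_app[OF f] E_ops E_closed E_neg l_neg)
  qed (auto intro!: E_eqI simp: E_closed E_ops a_ac E_app)
  show "monoid E"
    by (rule monoidI) (auto intro!: E_eqI simp: E_closed E_ops E_app)
qed (auto intro!: E_eqI simp: E_closed E_ops E_add E_app)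

sublocale E: ring E by (rule ring_E)

lemma E_uminus: "f \<in> carrier E \<Longrightarrow> x \<in> carrier L \<Longrightarrow> (\<ominus>\<^bsub>E\<^esub> f) x = \<ominus> f x"
proof -
  assume f: "f \<in> carrier E" and x: "x \<in> carrier L"
  have "(\<lambda>x \<in> carrier L. \<ominus> f x) \<oplus>\<^bsub>E\<^esub> f = \<zero>\<^bsub>E\<^esub>"
    by (rule E_eqI) (simp_all add: f E_ops E_closed E_neg E_app[OF f] l_neg)
  then have "\<ominus>\<^bsub>E\<^esub> f = (\<lambda>x \<in> carrier L. \<ominus> f x)"
    using E.minus_equality[OF _ f E_neg[OF f]] by simp
  with x show ?thesis by simp
qed

lemma lmult_closed: "l \<in> carrier L \<Longrightarrow> lmult L l \<in> carrier E"
  by (rule E_I) (simp_all add: lmult_def r_distr m_lcomm)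

lemma lmult_app: "x \<in> carrier L \<Longrightarrow> lmult L l x = l \<otimes> x"
  by (simp add: lmult_def)

section \<open>The automorphism group inside the endomorphism algebra\<close>

lemma Gal_hom: "g \<in> Gal L \<Gamma> \<Longrightarrow> g \<in> ring_hom L L"
  by (auto simp: Gal_def ring_iso_def)

lemma Gal_app: "g \<in> Gal L \<Gamma> \<Longrightarrow> x \<in> carrier L \<Longrightarrow> g x \<in> carrier L"
  by (rule ring_hom_memE(1)[OF Gal_hom])

lemma Gal_fix: "g \<in> Gal L \<Gamma> \<Longrightarrow> \<gamma> \<in> \<Gamma> \<Longrightarrow> g \<gamma> = \<gamma>"
  by (simp add: Gal_def)

lemma Gal_hom_ring: "g \<in> Gal L \<Gamma> \<Longrightarrow> ring_hom_ring L L g"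
  using Gal_hom ring_hom_ringI2[OF ring_axioms ring_axioms] by blast

lemma Gal_ops:
  assumes "g \<in> Gal L \<Gamma>"
  shows "x \<in> carrier L \<Longrightarrow> y \<in> carrier L \<Longrightarrow> g (x \<oplus> y) = g x \<oplus> g y"
    "x \<in> carrier L \<Longrightarrow> y \<in> carrier L \<Longrightarrow> g (x \<otimes> y) = g x \<otimes> g y"
    "g \<one> = \<one>" "g \<zero> = \<zero>" "x \<in> carrier L \<Longrightarrow> g (\<ominus> x) = \<ominus> g x"
proof -
  interpret g: ring_hom_ring L L g by (rule Gal_hom_ring[OF assms])
  show "x \<in> carrier L \<Longrightarrow> y \<in> carrier L \<Longrightarrow> g (x \<oplus> y) = g x \<oplus> g y"
    "x \<in> carrier L \<Longrightarrow> y \<in> carrier L \<Longrightarrow> g (x \<otimes> y) = g x \<otimes> g y"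
    "g \<one> = \<one>" "g \<zero> = \<zero>" "x \<in> carrier L \<Longrightarrow> g (\<ominus> x) = \<ominus> g x" by auto
qed

lemma Gal_extensional: "g \<in> Gal L \<Gamma> \<Longrightarrow> g \<in> extensional (carrier L)"
  by (simp add: Gal_def)

lemma Gal_in_E: "g \<in> G \<Longrightarrow> g \<in> carrier E"
proof (rule E_I)
  assume g: "g \<in> G"
  show "g (k \<otimes> x) = k \<otimes> g x" if "k \<in> K" "x \<in> carrier L" for k x
    using Gal_ops(2)[OF g] Gal_fix[OF g] that by simp
qed (rule Gal_extensional Gal_app Gal_ops(1), assumption+)+

lemma Gal_mono: "K \<subseteq> \<Gamma> \<Longrightarrow> Gal L \<Gamma> \<subseteq> G"
  by (auto simp: Gal_def)

lemma Gal_bij: "g \<in> Gal L \<Gamma> \<Longrightarrow> bij_betw g (carrier L) (carrier L)"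
  by (simp add: Gal_def ring_iso_def)

lemma Gal_inj: "g \<in> Gal L \<Gamma> \<Longrightarrow> inj_on g (carrier L)"
  and Gal_surj: "g \<in> Gal L \<Gamma> \<Longrightarrow> g ` carrier L = carrier L"
  by (auto simp: Gal_def ring_iso_def bij_betw_def)

lemma Gal_eqI:
  assumes "g \<in> Gal L \<Gamma>" "h \<in> Gal L \<Gamma>'" "\<And>x. x \<in> carrier L \<Longrightarrow> g x = h x"
  shows "g = h"
  using assms by (intro extensionalityI[of g "carrier L"] Gal_extensional)

lemma Gal_I:
  assumes "g \<in> ring_hom L L" "bij_betw g (carrier L) (carrier L)"
    and "g \<in> extensional (carrier L)" "\<And>\<gamma>. \<gamma> \<in> \<Gamma> \<Longrightarrow> g \<gamma> = \<gamma>"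
  shows "g \<in> Gal L \<Gamma>"
  using assms by (simp add: Gal_def ring_iso_def)

lemma Gal_one: "\<one>\<^bsub>E\<^esub> \<in> Gal L \<Gamma>" if "\<Gamma> \<subseteq> carrier L"
proof (rule Gal_I)
  show "\<one>\<^bsub>E\<^esub> \<in> ring_hom L L"
    by (rule ring_hom_memI) (simp_all add: E_ops)
  show "bij_betw \<one>\<^bsub>E\<^esub> (carrier L) (carrier L)"
    by (rule bij_betw_cong[THEN iffD1, OF _ bij_betw_id]) (simp add: E_ops)
  show "\<one>\<^bsub>E\<^esub> \<in> extensional (carrier L)" by (simp add: End_alg_def)
  show "\<one>\<^bsub>E\<^esub> \<gamma> = \<gamma>" if "\<gamma> \<in> \<Gamma>" for \<gamma>
    using that \<open>\<Gamma> \<subseteq> carrier L\<close> by (intro E_ops) auto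
qed

lemma Gal_mult:
  assumes g: "g \<in> Gal L \<Gamma>" and h: "h \<in> Gal L \<Gamma>" and "\<Gamma> \<subseteq> carrier L"
  shows "g \<otimes>\<^bsub>E\<^esub> h \<in> Gal L \<Gamma>"
proof (rule Gal_I)
  show "g \<otimes>\<^bsub>E\<^esub> h \<in> ring_hom L L"
    by (rule ring_hom_memI) (simp_all add: E_ops Gal_app[OF g] Gal_app[OF h]
        Gal_ops[OF g] Gal_ops[OF h])
  show "bij_betw (g \<otimes>\<^bsub>E\<^esub> h) (carrier L) (carrier L)"
  proof (rule bij_betw_cong[THEN iffD1])
    show "bij_betw (g \<circ> h) (carrier L) (carrier L)"
      by (rule bij_betw_trans[OF Gal_bij[OF h] Gal_bij[OF g]])
  qed (simp add: E_ops)
  show "g \<otimes>\<^bsub>E\<^esub> h \<in> extensional (carrier L)" by (simp add: End_alg_def)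
  show "(g \<otimes>\<^bsub>E\<^esub> h) \<gamma> = \<gamma>" if "\<gamma> \<in> \<Gamma>" for \<gamma>
    using that \<open>\<Gamma> \<subseteq> carrier L\<close> Gal_fix[OF g that] Gal_fix[OF h that] E_ops(1)[of \<gamma> g h] by auto
qed

text \<open>
  Stated for the multiplication of \<open>E\<close>, so that the inverse in \<open>E\<close> (which is the one in the definition
  of an invariant subalgebra) and the inverse in the group are both identified with an automorphism.
\<close>

lemma Gal_inverse:
  assumes g: "g \<in> Gal L \<Gamma>" and \<Gamma>: "\<Gamma> \<subseteq> carrier L"
  obtains h where "h \<in> Gal L \<Gamma>" "g \<otimes>\<^bsub>E\<^esub> h = \<one>\<^bsub>E\<^esub>" "h \<otimes>\<^bsub>E\<^esub> g = \<one>\<^bsub>E\<^esub>"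
proof -
  let ?h = "restrict (inv_into (carrier L) g) (carrier L)"
  have 1: "?h (g x) = x" if "x \<in> carrier L" for x
    using that Gal_inj[OF g] Gal_app[OF g] by simp
  have 2: "g (?h x) = x" if "x \<in> carrier L" for x
    using that Gal_surj[OF g] by (simp add: f_inv_into_f)
  have "inv_into (carrier L) g \<in> ring_iso L L"
    using ring_iso_set_sym[OF ring_axioms] g by (auto simp: Gal_def)
  then have "?h \<in> ring_iso L L"
    by (rule ring_iso_restrict) simp
  moreover have "?h \<gamma> = \<gamma>" if "\<gamma> \<in> \<Gamma>" for \<gamma>
    using 1[of \<gamma>] that \<Gamma> Gal_fix[OF g] by auto
  ultimately have h: "?h \<in> Gal L \<Gamma>" by (auto simp: Gal_def)
  show ?thesis
  proof
    show "g \<otimes>\<^bsub>E\<^esub> ?h = \<one>\<^bsub>E\<^esub>"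
      by (rule Gal_eqI[OF Gal_mult[OF g h \<Gamma>] Gal_one[OF \<Gamma>]]) (simp add: E_ops 2 del: restrict_apply)
    show "?h \<otimes>\<^bsub>E\<^esub> g = \<one>\<^bsub>E\<^esub>"
      by (rule Gal_eqI[OF Gal_mult[OF h g \<Gamma>] Gal_one[OF \<Gamma>]]) (simp add: E_ops 1 del: restrict_apply)
  qed (rule h)
qed

lemma Gal_subset_Bij: "Gal L \<Gamma> \<subseteq> Bij (carrier L)"
  by (auto simp: Gal_def Bij_def ring_iso_def)

lemma Gal_group_ops:
  assumes "g \<in> G" "h \<in> G"
  shows "g \<otimes>\<^bsub>Gal_group L K\<^esub> h = g \<otimes>\<^bsub>E\<^esub> h"
  using assms Gal_subset_Bij by (auto simp: Gal_group_def BijGroup_def End_alg_def subsetD)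

lemma Gal_group_one: "\<one>\<^bsub>Gal_group L K\<^esub> = \<one>\<^bsub>E\<^esub>"
  by (simp add: Gal_group_def BijGroup_def End_alg_def)

lemma Gal_group_carrier: "carrier (Gal_group L K) = G"
  by (simp add: Gal_group_def)

lemma K_subset: "K \<subseteq> carrier L" by auto

lemma group_Gal: "group (Gal_group L K)"
proof (rule groupI)
  fix g assume "g \<in> carrier (Gal_group L K)"
  then have g: "g \<in> G" by (simp add: Gal_group_carrier)
  from Gal_inverse[OF g K_subset] obtain h where "h \<in> G" "h \<otimes>\<^bsub>E\<^esub> g = \<one>\<^bsub>E\<^esub>" by metis
  with g show "\<exists>h \<in> carrier (Gal_group L K). h \<otimes>\<^bsub>Gal_group L K\<^esub> g = \<one>\<^bsub>Gal_group L K\<^esub>"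
    by (auto simp: Gal_group_carrier Gal_group_ops Gal_group_one)
qed (auto simp: Gal_group_carrier Gal_group_ops Gal_group_one Gal_mult Gal_one K_subset Gal_in_E E.m_assoc)

sublocale G: group "Gal_group L K" by (rule group_Gal)

lemma Gal_group_inv: "g \<in> G \<Longrightarrow> inv\<^bsub>Gal_group L K\<^esub> g = inv\<^bsub>E\<^esub> g"
  and inv_E_Gal: "g \<in> G \<Longrightarrow> inv\<^bsub>E\<^esub> g \<in> G"
  and inv_E_l: "g \<in> G \<Longrightarrow> inv\<^bsub>E\<^esub> g \<otimes>\<^bsub>E\<^esub> g = \<one>\<^bsub>E\<^esub>"
  and inv_E_r: "g \<in> G \<Longrightarrow> g \<otimes>\<^bsub>E\<^esub> inv\<^bsub>E\<^esub> g = \<one>\<^bsub>E\<^esub>"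
proof -
  assume g: "g \<in> G"
  from Gal_inverse[OF g K_subset] obtain h where h: "h \<in> G" "g \<otimes>\<^bsub>E\<^esub> h = \<one>\<^bsub>E\<^esub>" "h \<otimes>\<^bsub>E\<^esub> g = \<one>\<^bsub>E\<^esub>" by metis
  have 1: "inv\<^bsub>E\<^esub> g = h"
    using E.inv_char[OF Gal_in_E[OF g] Gal_in_E[OF h(1)]] h by simp
  have 2: "inv\<^bsub>Gal_group L K\<^esub> g = h"
    using G.inv_equality[of h g] h g by (simp add: Gal_group_ops Gal_group_one Gal_group_carrier)
  show "inv\<^bsub>Gal_group L K\<^esub> g = inv\<^bsub>E\<^esub> g" "inv\<^bsub>E\<^esub> g \<in> G" "inv\<^bsub>E\<^esub> g \<otimes>\<^bsub>E\<^esub> g = \<one>\<^bsub>E\<^esub>"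
    "g \<otimes>\<^bsub>E\<^esub> inv\<^bsub>E\<^esub> g = \<one>\<^bsub>E\<^esub>" using 1 2 h by auto
qed

lemma inv_E_app:
  assumes "g \<in> G" "x \<in> carrier L"
  shows "(inv\<^bsub>E\<^esub> g) (g x) = x" "g ((inv\<^bsub>E\<^esub> g) x) = x"
proof -
  have "(inv\<^bsub>E\<^esub> g \<otimes>\<^bsub>E\<^esub> g) x = x" "(g \<otimes>\<^bsub>E\<^esub> inv\<^bsub>E\<^esub> g) x = x"
    unfolding inv_E_l[OF assms(1)] inv_E_r[OF assms(1)] by (rule E_ops(3)[OF assms(2)])+
  then show "(inv\<^bsub>E\<^esub> g) (g x) = x" "g ((inv\<^bsub>E\<^esub> g) x) = x"
    unfolding E_ops(1)[OF assms(2)] .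
qed

lemma subalgebra_iff:
  "is_subalgebra L K A \<longleftrightarrow> subring A E \<and> (\<forall>k \<in> K. \<forall>a \<in> A. lmult L k \<otimes>\<^bsub>E\<^esub> a \<in> A)"
  unfolding is_subalgebra_def subalgebra_def subalgebra_axioms_def subring_def by blast

section \<open>Independence of automorphisms\<close>

text \<open>
  A sum of two or more terms can be shortened without leaving \<open>A\<close> and without losing the coefficient
  at \<open>g\<close>: choose \<open>h \<noteq> g\<close> in the support and \<open>y\<close> with \<open>h y \<noteq> g y\<close>, and replace \<open>a\<close> by \<open>a y - h(y) a\<close>,
  which multiplies the coefficient at \<open>s\<close> by \<open>s(y) - h(y)\<close>.  A sum of one term is a nonzero multiple
  of \<open>g\<close>.
\<close>

lemma automorphism_in_bimodule:
  assumes A: "A \<subseteq> carrier E"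
    and minus: "\<And>a b. a \<in> A \<Longrightarrow> b \<in> A \<Longrightarrow> a \<ominus>\<^bsub>E\<^esub> b \<in> A"
    and left: "\<And>l a. l \<in> carrier L \<Longrightarrow> a \<in> A \<Longrightarrow> lmult L l \<otimes>\<^bsub>E\<^esub> a \<in> A"
    and right: "\<And>l a. l \<in> carrier L \<Longrightarrow> a \<in> A \<Longrightarrow> a \<otimes>\<^bsub>E\<^esub> lmult L l \<in> A"
    and S: "finite S" "S \<subseteq> G" "l \<in> S \<rightarrow> carrier L" "g \<in> S" "l g \<noteq> \<zero>"
    and a: "a \<in> A" "\<And>x. x \<in> carrier L \<Longrightarrow> a x = (\<Oplus>s\<in>S. l s \<otimes> s x)"
  shows "g \<in> A"
  using S a
proof (induction "card S" arbitrary: S l a)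
  case 0
  then show ?case by auto
next
  case (Suc n)
  have g: "g \<in> G" "g \<in> carrier E" using Suc.prems Gal_in_E by auto
  have lg: "l g \<in> carrier L" using Suc.prems by auto
  have aE: "a \<in> carrier E" using Suc.prems A by auto
  show ?case
  proof (cases "S = {g}")
    case True
    have inv: "inv (l g) \<in> carrier L" "inv (l g) \<otimes> l g = \<one>"
      using lg Suc.prems(5) field_Units by auto
    have "lmult L (inv (l g)) \<otimes>\<^bsub>E\<^esub> a = g"
    proof (rule E_eqI)
      show "lmult L (inv (l g)) \<otimes>\<^bsub>E\<^esub> a \<in> carrier E"
        by (intro E_closed lmult_closed inv aE)
      fix x assume x: "x \<in> carrier L"
      have "(lmult L (inv (l g)) \<otimes>\<^bsub>E\<^esub> a) x = inv (l g) \<otimes> (l g \<otimes> g x)"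
        using x Suc.prems(7)[OF x] lg Gal_app[OF g(1) x] by (simp add: E_ops lmult_app True)
      also have "\<dots> = g x"
        using inv lg Gal_app[OF g(1) x] by (simp flip: m_assoc)
      finally show "(lmult L (inv (l g)) \<otimes>\<^bsub>E\<^esub> a) x = g x" .
    qed (rule g)
    with left[OF inv(1) Suc.prems(6)] show ?thesis by simp
  next
    case False
    then obtain h where h: "h \<in> S" "h \<noteq> g" using Suc.prems(4) by auto
    have hG: "h \<in> G" using h Suc.prems by auto
    obtain y where y: "y \<in> carrier L" "h y \<noteq> g y" using Gal_eqI[OF hG g(1)] h by metis
    note hy = Gal_app[OF hG y(1)]
    define b where "b = a \<otimes>\<^bsub>E\<^esub> lmult L y \<ominus>\<^bsub>E\<^esub> lmult L (h y) \<otimes>\<^bsub>E\<^esub> a"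
    define m where "m s = l s \<otimes> (s y \<ominus> h y)" for s
    have s: "s \<in> G" "l s \<in> carrier L" "s y \<in> carrier L" if "s \<in> S" for s
      using that Suc.prems Gal_app[OF _ y(1)] by auto
    have "b x = (\<Oplus>s\<in>S - {h}. m s \<otimes> s x)" if x: "x \<in> carrier L" for x
    proof -
      have sx: "s x \<in> carrier L" if "s \<in> S" for s using s(1)[OF that] x Gal_app by blast
      have "b x = a (y \<otimes> x) \<ominus> h y \<otimes> a x"
        using x y hy E_app[OF aE x] aE unfolding b_def a_minus_def
        by (simp add: E_ops lmult_app E_uminus E_closed lmult_closed)
      also have "\<dots> = (\<Oplus>s\<in>S. l s \<otimes> s (y \<otimes> x)) \<ominus> h y \<otimes> (\<Oplus>s\<in>S. l s \<otimes> s x)"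
        using x y by (simp add: Suc.prems(7))
      also have "\<dots> = (\<Oplus>s\<in>S. l s \<otimes> s (y \<otimes> x)) \<oplus> (\<Oplus>s\<in>S. (\<ominus> h y) \<otimes> (l s \<otimes> s x))"
        using finsum_rdistr[of S "\<ominus> h y" "\<lambda>s. l s \<otimes> s x"] hy sx s(2) Suc.prems(1)
        by (simp add: a_minus_def l_minus Pi_iff)
      also have "\<dots> = (\<Oplus>s\<in>S. l s \<otimes> s (y \<otimes> x) \<oplus> (\<ominus> h y) \<otimes> (l s \<otimes> s x))"
        using x y hy sx s(2) by (subst finsum_addf) (auto simp: Gal_app[OF s(1)])
      also have "\<dots> = (\<Oplus>s\<in>S. m s \<otimes> s x)"
      proof (rule finsum_cong')
        show "(\<lambda>s. m s \<otimes> s x) \<in> S \<rightarrow> carrier L"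
          using s sx hy by (auto simp: m_def)
        fix t assume t: "t \<in> S"
        show "l t \<otimes> t (y \<otimes> x) \<oplus> \<ominus> h y \<otimes> (l t \<otimes> t x) = m t \<otimes> t x"
          unfolding Gal_ops(2)[OF s(1)[OF t] y(1) x] m_def
          using s(2,3)[OF t] sx[OF t] hy by algebra
      qed simp
      also have "\<dots> = m h \<otimes> h x \<oplus> (\<Oplus>s\<in>S - {h}. m s \<otimes> s x)"
        using h(1) s sx hy Suc.prems(1)
        by (subst finsum_insert[symmetric]) (auto simp: m_def insert_absorb)
      also have "m h = \<zero>" using s[OF h(1)] by (simp add: m_def r_neg a_minus_def)
      finally show ?thesis using s sx hy h(1) by (simp add: m_def Pi_iff)
    qed
    moreover have "b \<in> A" unfolding b_def
      using y hy Suc.prems by (intro minus left right)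
    moreover have "m \<in> (S - {h}) \<rightarrow> carrier L" using s hy by (auto simp: m_def)
    moreover have "m g \<noteq> \<zero>"
    proof -
      have "g y \<ominus> h y \<noteq> \<zero>" using y(2) hy s(3)[OF Suc.prems(4)] by (simp add: r_right_minus_eq)
      then show ?thesis
        using Suc.prems(5) lg hy s(3)[OF Suc.prems(4)] by (auto simp: m_def integral_iff)
    qed
    moreover have "n = card (S - {h})" using Suc.hyps(2) h Suc.prems(1) by simp
    ultimately show ?thesis
      using Suc.hyps(1)[of "S - {h}" m b] Suc.prems h by blast
  qed
qed

text \<open>
  The zero bimodule contains no automorphism.
\<close>

lemma Dedekind_independence:
  assumes "finite S" "S \<subseteq> G" "l \<in> S \<rightarrow> carrier L" "g \<in> S"
    and "\<And>x. x \<in> carrier L \<Longrightarrow> (\<Oplus>s\<in>S. l s \<otimes> s x) = \<zero>"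
  shows "l g = \<zero>"
proof (rule ccontr)
  assume "l g \<noteq> \<zero>"
  have "g \<in> {\<zero>\<^bsub>E\<^esub>}"
  proof (rule automorphism_in_bimodule[OF _ _ _ _ assms(1-4) \<open>l g \<noteq> \<zero>\<close>])
    fix x assume "x \<in> carrier L"
    then show "\<zero>\<^bsub>E\<^esub> x = (\<Oplus>s\<in>S. l s \<otimes> s x)" using assms(5) by (simp add: E_ops)
  qed (simp_all add: lmult_closed E.minus_eq)
  then have "g \<one> = \<zero>" by (simp add: E_ops)
  then show False using Gal_ops(3)[of g K] assms by auto
qed

text \<open>
  An automorphism is determined by its values on a \<open>K\<close>-basis of \<open>L\<close>, and each basis vector can only
  be sent to one of the finitely many roots of its minimal polynomial.
\<close>

lemma finite_Gal: "finite G"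
proof -
  obtain n where "dimension n K (carrier L)" using finite_dim by (auto simp: finite_dimension_def)
  then obtain Us where Us: "set Us \<subseteq> carrier L" "Span K Us = carrier L"
    using exists_base[OF subfield_K] by blast
  have alg: "(algebraic over K) x" if "x \<in> carrier L" for x
    using finite_dimension_imp_algebraic[OF subfield_K carrier_is_subring finite_dim that] .
  let ?R = "\<Union>u\<in>set Us. {y. is_root (Irr K u) y}"
  have "finite ?R"
    using Us(1) IrrE(1)[OF subfield_K _ alg] finite_number_of_roots
      carrier_polynomial_shell[OF subfieldE(1)[OF subfield_K]] by auto
  then have fin: "finite {ys. set ys \<subseteq> ?R \<and> length ys = length Us}" by (rule finite_lists_length_eq)
  have img: "(\<lambda>g. map g Us) ` G \<subseteq> {ys. set ys \<subseteq> ?R \<and> length ys = length Us}"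
  proof safe
    fix g y assume g: "g \<in> G" and "y \<in> set (map g Us)"
    then obtain u where u: "u \<in> set Us" "y = g u" by auto
    interpret g: ring_hom_ring L L g by (rule Gal_hom_ring[OF g])
    have uL: "u \<in> carrier L" using u Us by auto
    note Irr = IrrE[OF subfield_K uL alg[OF uL]]
    have "set (Irr K u) \<subseteq> K" using Irr(1) by (auto simp: polynomial_def simp flip: univ_poly_carrier)
    then have "map g (Irr K u) = Irr K u" by (intro map_idI) (auto simp: Gal_fix[OF g])
    then have "eval (Irr K u) (g u) = \<zero>"
      using g.eval_hom[OF subfieldE(1)[OF subfield_K] uL Irr(1)] Irr(4) by (simp add: Gal_ops[OF g])
    moreover have "Irr K u \<noteq> []"
      using pirreducibleE(1)[OF subfieldE(1)[OF subfield_K] Irr(1,2)] .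
    ultimately show "y \<in> ?R" using u uL Gal_app[OF g uL] by (auto simp: is_root_def)
  qed simp
  have inj: "inj_on (\<lambda>g. map g Us) G"
  proof (rule inj_onI)
    fix g h assume g: "g \<in> G" and h: "h \<in> G" and eq: "map g Us = map h Us"
    interpret g: ring_hom_ring L L g by (rule Gal_hom_ring[OF g])
    interpret h: ring_hom_ring L L h by (rule Gal_hom_ring[OF h])
    show "g = h"
    proof (rule Gal_eqI[OF g h])
      fix x assume "x \<in> carrier L"
      then have "x \<in> {combine Ks Us | Ks. set Ks \<subseteq> K}"
        using Span_eq_combine_set[OF subfield_K Us(1)] Us(2) by (simp del: Span.simps)
      then obtain Ks where Ks: "set Ks \<subseteq> K" "x = combine Ks Us" by blast
      have "map g Ks = Ks" "map h Ks = Ks"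
        using Ks(1) by (auto intro!: map_idI simp: Gal_fix[OF g] Gal_fix[OF h] subset_iff)
      moreover have "set Ks \<subseteq> carrier L" using Ks(1) K_subset by (rule subset_trans)
      ultimately show "g x = h x"
        using g.combine_hom[OF _ Us(1), of Ks] h.combine_hom[OF _ Us(1), of Ks] by (simp add: Ks(2) eq)
    qed
  qed
  show ?thesis by (rule finite_imageD[OF finite_subset[OF img fin] inj])
qed

lemma inv_E_cancel:
  assumes h: "h \<in> G" and f: "f \<in> carrier E"
  shows "inv\<^bsub>E\<^esub> h \<otimes>\<^bsub>E\<^esub> (h \<otimes>\<^bsub>E\<^esub> f) = f"
  using f Gal_in_E[OF h] Gal_in_E[OF inv_E_Gal[OF h]]
  by (subst E.m_assoc[symmetric]) (simp_all add: inv_E_l[OF h])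

lemma inj_on_translate:
  assumes "h \<in> G" "S \<subseteq> G"
  shows "inj_on (\<lambda>g. h \<otimes>\<^bsub>E\<^esub> g) S"
  by (rule inj_on_inverseI[of _ "\<lambda>g. inv\<^bsub>E\<^esub> h \<otimes>\<^bsub>E\<^esub> g"])
    (use assms inv_E_cancel Gal_in_E in auto)

text \<open>
  Translation by \<open>h\<close> is injective and \<open>G\<close> is finite.  With \<open>h \<in> S\<close> and \<open>1 \<in> S\<close> this yields the inverse
  of \<open>h\<close> in \<open>S\<close>, so that a submonoid of \<open>G\<close> is a subgroup.
\<close>

lemma translate_image:
  assumes h: "h \<in> G" and S: "S \<subseteq> G" and closed: "\<And>g. g \<in> S \<Longrightarrow> h \<otimes>\<^bsub>E\<^esub> g \<in> S"
  shows "(\<lambda>g. h \<otimes>\<^bsub>E\<^esub> g) ` S = S"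
  using closed by (intro endo_inj_surj finite_subset[OF S finite_Gal] inj_on_translate[OF h S]) auto

section \<open>Centralizers and skew group rings\<close>

lemma subalgebra_I:
  assumes "A \<subseteq> carrier E" "\<one>\<^bsub>E\<^esub> \<in> A" "lmult L ` K \<subseteq> A"
    and "\<And>a b. a \<in> A \<Longrightarrow> b \<in> A \<Longrightarrow> a \<oplus>\<^bsub>E\<^esub> b \<in> A"
    and "\<And>a b. a \<in> A \<Longrightarrow> b \<in> A \<Longrightarrow> a \<otimes>\<^bsub>E\<^esub> b \<in> A"
    and "\<And>a. a \<in> A \<Longrightarrow> \<ominus>\<^bsub>E\<^esub> a \<in> A"
  shows "is_subalgebra L K A"
  unfolding subalgebra_iff
  using assms by (auto intro!: E.subringI)

lemma subalgebraD:
  assumes "is_subalgebra L K A"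
  shows "A \<subseteq> carrier E" "\<one>\<^bsub>E\<^esub> \<in> A"
    "\<And>a b. a \<in> A \<Longrightarrow> b \<in> A \<Longrightarrow> a \<oplus>\<^bsub>E\<^esub> b \<in> A"
    "\<And>a b. a \<in> A \<Longrightarrow> b \<in> A \<Longrightarrow> a \<otimes>\<^bsub>E\<^esub> b \<in> A"
    "\<And>a. a \<in> A \<Longrightarrow> \<ominus>\<^bsub>E\<^esub> a \<in> A"
    "\<And>a b. a \<in> A \<Longrightarrow> b \<in> A \<Longrightarrow> a \<ominus>\<^bsub>E\<^esub> b \<in> A"
proof -
  have A: "subring A E" using assms by (simp add: subalgebra_iff)
  show "A \<subseteq> carrier E" "\<one>\<^bsub>E\<^esub> \<in> A"
    "\<And>a b. a \<in> A \<Longrightarrow> b \<in> A \<Longrightarrow> a \<oplus>\<^bsub>E\<^esub> b \<in> A"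
    "\<And>a b. a \<in> A \<Longrightarrow> b \<in> A \<Longrightarrow> a \<otimes>\<^bsub>E\<^esub> b \<in> A"
    "\<And>a. a \<in> A \<Longrightarrow> \<ominus>\<^bsub>E\<^esub> a \<in> A"
    by (fact subringE(1)[OF A], fact subringE(3)[OF A], fact subringE(7)[OF A],
        fact subringE(6)[OF A], fact subringE(5)[OF A])
  then show "\<And>a b. a \<in> A \<Longrightarrow> b \<in> A \<Longrightarrow> a \<ominus>\<^bsub>E\<^esub> b \<in> A" by (simp add: a_minus_def)
qed

lemma lmult_mult:
  "l \<in> carrier L \<Longrightarrow> m \<in> carrier L \<Longrightarrow> lmult L l \<otimes>\<^bsub>E\<^esub> lmult L m = lmult L (l \<otimes> m)"
  by (rule E_eqI) (simp_all add: lmult_closed E_ops lmult_app m_assoc)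

lemma lmult_commute:
  "l \<in> carrier L \<Longrightarrow> m \<in> carrier L \<Longrightarrow> lmult L l \<otimes>\<^bsub>E\<^esub> lmult L m = lmult L m \<otimes>\<^bsub>E\<^esub> lmult L l"
  by (simp add: lmult_mult m_comm)

lemma K_central: "k \<in> K \<Longrightarrow> f \<in> carrier E \<Longrightarrow> lmult L k \<otimes>\<^bsub>E\<^esub> f = f \<otimes>\<^bsub>E\<^esub> lmult L k"
  by (rule E_eqI) (simp_all add: lmult_closed E_ops lmult_app E_app E_smult)

lemma centralizer_subalgebra:
  assumes S: "S \<subseteq> carrier E"
  shows "is_subalgebra L K (centralizer E S)"
proof (rule subalgebra_I)
  note [simp] = subsetD[OF S]
  show "\<And>a b. a \<in> centralizer E S \<Longrightarrow> b \<in> centralizer E S \<Longrightarrow> a \<oplus>\<^bsub>E\<^esub> b \<in> centralizer E S"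
    by (auto simp: centralizer_def E.l_distr E.r_distr)
  show "a \<otimes>\<^bsub>E\<^esub> b \<in> centralizer E S" if a: "a \<in> centralizer E S" and b: "b \<in> centralizer E S" for a b
  proof -
    have "a \<otimes>\<^bsub>E\<^esub> b \<otimes>\<^bsub>E\<^esub> s = s \<otimes>\<^bsub>E\<^esub> (a \<otimes>\<^bsub>E\<^esub> b)" if s: "s \<in> S" for s
    proof -
      have "a \<otimes>\<^bsub>E\<^esub> b \<otimes>\<^bsub>E\<^esub> s = a \<otimes>\<^bsub>E\<^esub> (s \<otimes>\<^bsub>E\<^esub> b)"
        using a b s by (simp add: centralizer_def E.m_assoc)
      also have "\<dots> = (a \<otimes>\<^bsub>E\<^esub> s) \<otimes>\<^bsub>E\<^esub> b"
        using a b s by (intro E.m_assoc[symmetric]) (auto simp: centralizer_def)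
      also have "\<dots> = s \<otimes>\<^bsub>E\<^esub> (a \<otimes>\<^bsub>E\<^esub> b)"
        using a b s by (simp add: centralizer_def E.m_assoc)
      finally show ?thesis .
    qed
    then show ?thesis using a b by (simp add: centralizer_def)
  qed
qed (auto simp: centralizer_def K_central lmult_closed E.l_minus E.r_minus subsetD[OF S])

text \<open>
  Commuting with the multiplication by \<open>l\<close> is \<open>l\<close>-linearity; hence \<open>C\<^sub>E(\<Gamma>)\<close> is the algebra of
  \<open>\<Gamma>\<close>-linear endomorphisms.
\<close>

lemma commutes_lmult_iff:
  assumes "f \<in> carrier E" "l \<in> carrier L"
  shows "f \<otimes>\<^bsub>E\<^esub> lmult L l = lmult L l \<otimes>\<^bsub>E\<^esub> f \<longleftrightarrow> (\<forall>x \<in> carrier L. f (l \<otimes> x) = l \<otimes> f x)"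
proof
  assume eq: "f \<otimes>\<^bsub>E\<^esub> lmult L l = lmult L l \<otimes>\<^bsub>E\<^esub> f"
  show "\<forall>x \<in> carrier L. f (l \<otimes> x) = l \<otimes> f x"
  proof
    fix x assume x: "x \<in> carrier L"
    show "f (l \<otimes> x) = l \<otimes> f x"
      using fun_cong[OF eq, of x] x assms E_app[OF assms(1) x] by (simp add: E_ops lmult_app)
  qed
next
  assume "\<forall>x \<in> carrier L. f (l \<otimes> x) = l \<otimes> f x"
  then show "f \<otimes>\<^bsub>E\<^esub> lmult L l = lmult L l \<otimes>\<^bsub>E\<^esub> f"
    by (intro E_eqI) (simp_all add: assms lmult_closed E_ops lmult_app E_app)
qed

lemma Gal_commutes_lmult_iff:
  assumes "g \<in> G" "l \<in> carrier L"
  shows "g \<otimes>\<^bsub>E\<^esub> lmult L l = lmult L l \<otimes>\<^bsub>E\<^esub> g \<longleftrightarrow> g l = l"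
proof -
  have "g l = l" if "\<forall>x \<in> carrier L. g (l \<otimes> x) = l \<otimes> g x"
    using bspec[OF that one_closed] assms by (simp add: Gal_ops[OF assms(1)])
  then show ?thesis
    using commutes_lmult_iff[OF Gal_in_E[OF assms(1)] assms(2)] assms by (auto simp: Gal_ops)
qed

definition intermediate :: "'a set \<Rightarrow> bool" where
  "intermediate \<Gamma> \<longleftrightarrow> subfield \<Gamma> L \<and> K \<subseteq> \<Gamma>"

lemma intermediateD:
  assumes "intermediate \<Gamma>"
  shows "subfield \<Gamma> L" "K \<subseteq> \<Gamma>" "\<Gamma> \<subseteq> carrier L" "subring \<Gamma> L"
  using assms subfieldE[of \<Gamma> L] by (auto simp: intermediate_def)

lemma centralizer_intermediate:
  assumes "\<Gamma> \<subseteq> carrier L"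
  shows "is_subalgebra L K (centralizer E (lmult L ` \<Gamma>))"
    "lmult L ` carrier L \<subseteq> centralizer E (lmult L ` \<Gamma>)"
  using assms by (auto intro!: centralizer_subalgebra simp: lmult_closed lmult_commute subset_iff)
    (auto simp: centralizer_def lmult_closed lmult_commute subset_iff)

lemma centralizer_Int_Gal:
  assumes "\<Gamma> \<subseteq> carrier L" "K \<subseteq> \<Gamma>"
  shows "centralizer E (lmult L ` \<Gamma>) \<inter> G = Gal L \<Gamma>"
proof -
  have "g \<in> centralizer E (lmult L ` \<Gamma>) \<longleftrightarrow> (\<forall>\<gamma> \<in> \<Gamma>. g \<gamma> = \<gamma>)" if "g \<in> G" for g
    using that assms Gal_commutes_lmult_iff[OF that] Gal_in_E[OF that]
    by (auto simp: centralizer_def)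
  then show ?thesis using assms(2) by (auto simp: Gal_def)
qed

lemma skew_subalgebra:
  assumes "H \<subseteq> G"
  shows "is_subalgebra L K (skew L K H)" "lmult L ` carrier L \<subseteq> skew L K H" "H \<subseteq> skew L K H"
    "\<And>A. is_subalgebra L K A \<Longrightarrow> lmult L ` carrier L \<subseteq> A \<Longrightarrow> H \<subseteq> A \<Longrightarrow> skew L K H \<subseteq> A"
proof -
  have E: "is_subalgebra L K (carrier E)"
    by (rule subalgebra_I) (auto simp: lmult_closed)
  moreover have "lmult L ` carrier L \<subseteq> carrier E" by (auto simp: lmult_closed)
  moreover have "H \<subseteq> carrier E" using assms Gal_in_E by blast
  ultimately have "skew L K H \<subseteq> carrier E" unfolding skew_def by (intro Inter_lower) simp
  then show "is_subalgebra L K (skew L K H)"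
  proof (rule subalgebra_I)
    show "lmult L ` K \<subseteq> skew L K H"
      using image_mono[OF K_subset, of "lmult L"] unfolding skew_def by blast
  qed (simp_all add: skew_def subalgebraD(2-5))
qed (auto simp: skew_def)

text \<open>
  The normal form \<open>\<Sum> l\<^sub>g g\<close> for the elements of \<open>L \<rtimes> G\<close>.  Multiplying two such sums and regrouping
  is avoided: the endomorphisms that map the set \<open>T\<close> of sums into itself by left multiplication form
  a subalgebra, and for \<open>L\<close> and \<open>G\<close> membership in it only concerns products whose first factor is a
  single term.  Hence it contains \<open>L \<rtimes> G\<close>, and applying it to \<open>1 \<in> T\<close> gives \<open>L \<rtimes> G \<subseteq> T\<close>.
\<close>

lemma skew_sum:
  assumes f: "f \<in> skew L K G"
  obtains l where "l \<in> G \<rightarrow> carrier L" "\<And>x. x \<in> carrier L \<Longrightarrow> f x = (\<Oplus>g\<in>G. l g \<otimes> g x)"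
proof -
  define T where "T = {f \<in> carrier E. \<exists>l \<in> G \<rightarrow> carrier L. \<forall>x \<in> carrier L. f x = (\<Oplus>g\<in>G. l g \<otimes> g x)}"
  have term_closed: "l g \<otimes> g x \<in> carrier L" if "l \<in> G \<rightarrow> carrier L" "g \<in> G" "x \<in> carrier L" for l g x
    using that Gal_app[OF that(2,3)] by auto
  have T_add: "s \<oplus>\<^bsub>E\<^esub> t \<in> T" if "s \<in> T" "t \<in> T" for s t
  proof -
    from that obtain l m where l: "l \<in> G \<rightarrow> carrier L" "\<forall>x \<in> carrier L. s x = (\<Oplus>g\<in>G. l g \<otimes> g x)"
      and m: "m \<in> G \<rightarrow> carrier L" "\<forall>x \<in> carrier L. t x = (\<Oplus>g\<in>G. m g \<otimes> g x)"
      by (auto simp: T_def)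
    have "(s \<oplus>\<^bsub>E\<^esub> t) x = (\<Oplus>g\<in>G. (l g \<oplus> m g) \<otimes> g x)" if x: "x \<in> carrier L" for x
    proof -
      have "(s \<oplus>\<^bsub>E\<^esub> t) x = (\<Oplus>g\<in>G. l g \<otimes> g x) \<oplus> (\<Oplus>g\<in>G. m g \<otimes> g x)"
        using x l m by (simp add: E_ops)
      also have "\<dots> = (\<Oplus>g\<in>G. l g \<otimes> g x \<oplus> m g \<otimes> g x)"
        using x term_closed l(1) m(1) by (intro finsum_addf[symmetric]) auto
      also have "\<dots> = (\<Oplus>g\<in>G. (l g \<oplus> m g) \<otimes> g x)"
      proof (rule finsum_cong')
        fix g assume g: "g \<in> G"
        show "l g \<otimes> g x \<oplus> m g \<otimes> g x = (l g \<oplus> m g) \<otimes> g x"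
          using funcset_mem[OF l(1) g] funcset_mem[OF m(1) g] Gal_app[OF g x] by (simp add: l_distr)
      next
        show "(\<lambda>g. (l g \<oplus> m g) \<otimes> g x) \<in> G \<rightarrow> carrier L"
          using l(1) m(1) x Gal_app by blast
      qed simp
      finally show ?thesis .
    qed
    moreover have "(\<lambda>g. l g \<oplus> m g) \<in> G \<rightarrow> carrier L" using l(1) m(1) by auto
    ultimately show ?thesis using that by (auto simp: T_def)
  qed
  have T_lmult: "lmult L c \<otimes>\<^bsub>E\<^esub> t \<in> T" if c: "c \<in> carrier L" and t: "t \<in> T" for c t
  proof -
    from t obtain l where l: "l \<in> G \<rightarrow> carrier L" "\<forall>x \<in> carrier L. t x = (\<Oplus>g\<in>G. l g \<otimes> g x)"
      and tE: "t \<in> carrier E" by (auto simp: T_def)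
    have "(lmult L c \<otimes>\<^bsub>E\<^esub> t) x = (\<Oplus>g\<in>G. (c \<otimes> l g) \<otimes> g x)" if x: "x \<in> carrier L" for x
    proof -
      have "(lmult L c \<otimes>\<^bsub>E\<^esub> t) x = c \<otimes> (\<Oplus>g\<in>G. l g \<otimes> g x)"
        using x l E_app[OF tE x] by (simp add: E_ops lmult_app)
      also have "\<dots> = (\<Oplus>g\<in>G. c \<otimes> (l g \<otimes> g x))"
        using x term_closed l(1) c finite_Gal by (intro finsum_rdistr) auto
      also have "\<dots> = (\<Oplus>g\<in>G. (c \<otimes> l g) \<otimes> g x)"
      proof (rule finsum_cong')
        fix g assume g: "g \<in> G"
        show "c \<otimes> (l g \<otimes> g x) = (c \<otimes> l g) \<otimes> g x"
          using funcset_mem[OF l(1) g] c Gal_app[OF g x] by (simp add: m_assoc)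
      next
        show "(\<lambda>g. (c \<otimes> l g) \<otimes> g x) \<in> G \<rightarrow> carrier L"
          using l(1) c x Gal_app by blast
      qed simp
      finally show ?thesis .
    qed
    moreover have "(\<lambda>g. c \<otimes> l g) \<in> G \<rightarrow> carrier L" using l(1) c by auto
    ultimately show ?thesis using c tE by (auto simp: T_def lmult_closed)
  qed
  have T_Gal: "h \<otimes>\<^bsub>E\<^esub> t \<in> T" if h: "h \<in> G" and t: "t \<in> T" for h t
  proof -
    from t obtain l where l: "l \<in> G \<rightarrow> carrier L" "\<forall>x \<in> carrier L. t x = (\<Oplus>g\<in>G. l g \<otimes> g x)"
      and tE: "t \<in> carrier E" by (auto simp: T_def)
    \<comment> \<open>\<open>h (\<Sum> l\<^sub>g g) = \<Sum> h(l\<^sub>g) hg\<close>; this is the coefficient after reindexing by \<open>hg\<close>\<close>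
    let ?l = "\<lambda>g. h (l (inv\<^bsub>E\<^esub> h \<otimes>\<^bsub>E\<^esub> g))"
    have l': "?l \<in> G \<rightarrow> carrier L"
      using l(1) Gal_app[OF h] Gal_mult[OF inv_E_Gal[OF h] _ K_subset] by auto
    have hE: "h \<in> carrier E" using Gal_in_E[OF h] .
    note inj = inj_on_translate[OF h order_refl]
    have img: "(\<lambda>g. h \<otimes>\<^bsub>E\<^esub> g) ` G = G"
      by (rule translate_image[OF h order_refl Gal_mult[OF h _ K_subset]])
    have "(h \<otimes>\<^bsub>E\<^esub> t) x = (\<Oplus>g\<in>G. ?l g \<otimes> g x)" if x: "x \<in> carrier L" for x
    proof -
      interpret h: ring_hom_ring L L h by (rule Gal_hom_ring[OF h])
      have "(h \<otimes>\<^bsub>E\<^esub> t) x = h (\<Oplus>g\<in>G. l g \<otimes> g x)"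
        using x l by (simp add: E_ops)
      also have "\<dots> = (\<Oplus>g\<in>G. h (l g \<otimes> g x))"
        using term_closed l(1) x h.hom_finsum[of "\<lambda>g. l g \<otimes> g x" G] by (auto simp: comp_def)
      also have "\<dots> = (\<Oplus>g\<in>G. ?l (h \<otimes>\<^bsub>E\<^esub> g) \<otimes> (h \<otimes>\<^bsub>E\<^esub> g) x)"
      proof (rule finsum_cong')
        fix g assume g: "g \<in> G"
        have "inv\<^bsub>E\<^esub> h \<otimes>\<^bsub>E\<^esub> (h \<otimes>\<^bsub>E\<^esub> g) = g"
          by (rule inv_E_cancel[OF h Gal_in_E[OF g]])
        then show "h (l g \<otimes> g x) = ?l (h \<otimes>\<^bsub>E\<^esub> g) \<otimes> (h \<otimes>\<^bsub>E\<^esub> g) x"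
          using funcset_mem[OF l(1) g] Gal_app[OF g x] x by (simp add: E_ops)
      next
        show "(\<lambda>g. ?l (h \<otimes>\<^bsub>E\<^esub> g) \<otimes> (h \<otimes>\<^bsub>E\<^esub> g) x) \<in> G \<rightarrow> carrier L"
        proof
          fix g assume "g \<in> G"
          with Gal_mult[OF h _ K_subset] have "h \<otimes>\<^bsub>E\<^esub> g \<in> G" by blast
          from term_closed[OF l' this x] show "?l (h \<otimes>\<^bsub>E\<^esub> g) \<otimes> (h \<otimes>\<^bsub>E\<^esub> g) x \<in> carrier L" .
        qed
      qed simp
      also have "\<dots> = (\<Oplus>g\<in>(\<lambda>g. h \<otimes>\<^bsub>E\<^esub> g) ` G. ?l g \<otimes> g x)"
        using term_closed[OF l' _ x] by (intro finsum_reindex[OF _ inj, symmetric]) (simp only: img, blast)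
      finally show ?thesis unfolding img .
    qed
    then show ?thesis using l' hE tE by (auto simp: T_def)
  qed
  have T_one: "\<one>\<^bsub>E\<^esub> \<in> T"
  proof -
    let ?l = "\<lambda>g. if g = \<one>\<^bsub>E\<^esub> then \<one> else \<zero>"
    have "\<one>\<^bsub>E\<^esub> x = (\<Oplus>g\<in>G. ?l g \<otimes> g x)" if x: "x \<in> carrier L" for x
    proof -
      have "(\<Oplus>g\<in>G. ?l g \<otimes> g x) = (\<Oplus>g\<in>G. if \<one>\<^bsub>E\<^esub> = g then x else \<zero>)"
        using x Gal_app[OF _ x] by (intro finsum_cong') (auto simp: E_ops)
      also have "\<dots> = x"
        using finsum_singleton[of "\<one>\<^bsub>E\<^esub>" G "\<lambda>_. x"] Gal_one[OF K_subset] finite_Gal x by auto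
      finally show ?thesis using x by (simp add: E_ops)
    qed
    then show ?thesis by (auto simp: T_def intro!: bexI[of _ ?l])
  qed
  have TE: "T \<subseteq> carrier E" by (auto simp: T_def)
  let ?A = "{f \<in> carrier E. \<forall>t \<in> T. f \<otimes>\<^bsub>E\<^esub> t \<in> T}"
  have "is_subalgebra L K ?A"
  proof (rule subalgebra_I)
    fix a assume a: "a \<in> ?A"
    have "\<ominus>\<^bsub>E\<^esub> a \<otimes>\<^bsub>E\<^esub> t = lmult L (\<ominus> \<one>) \<otimes>\<^bsub>E\<^esub> (a \<otimes>\<^bsub>E\<^esub> t)" if t: "t \<in> T" for t
    proof (rule E_eqI)
      have E: "a \<in> carrier E" "t \<in> carrier E" using a t TE by auto
      fix x assume x: "x \<in> carrier L"
      show "(\<ominus>\<^bsub>E\<^esub> a \<otimes>\<^bsub>E\<^esub> t) x = (lmult L (\<ominus> \<one>) \<otimes>\<^bsub>E\<^esub> (a \<otimes>\<^bsub>E\<^esub> t)) x"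
        using x E E_app[OF E(2) x] E_app[OF E(1) E_app[OF E(2) x]]
        by (simp add: E_ops E_uminus lmult_app l_minus)
    qed (use a t TE in \<open>auto simp: lmult_closed\<close>)
    then show "\<ominus>\<^bsub>E\<^esub> a \<in> ?A" using a T_lmult by auto
  qed (use TE T_add T_lmult in \<open>auto simp: E.l_distr E.m_assoc lmult_closed subset_iff\<close>)
  then have "skew L K G \<subseteq> ?A"
    using T_Gal T_lmult Gal_in_E lmult_closed by (intro skew_subalgebra(4)) auto
  with f T_one have "f \<otimes>\<^bsub>E\<^esub> \<one>\<^bsub>E\<^esub> \<in> T" "f \<in> carrier E" by auto
  then have "f \<in> T" by simp
  with that show thesis by (auto simp: T_def)
qed

section \<open>Fixed fields\<close>

lemma fixed_field_intermediate:
  assumes "H \<subseteq> G"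
  shows "intermediate (fixed_field L H)"
  unfolding intermediate_def
proof
  show "K \<subseteq> fixed_field L H"
    using assms Gal_fix[of _ K] by (auto simp: fixed_field_def)
  have h: "h \<in> G" if "h \<in> H" for h using that assms by auto
  show "subfield (fixed_field L H) L"
  proof (rule subfieldI')
    show "subring (fixed_field L H) L"
    proof (rule subringI)
      fix x y assume "x \<in> fixed_field L H" "y \<in> fixed_field L H"
      then have xy: "x \<in> carrier L" "y \<in> carrier L" "\<And>g. g \<in> H \<Longrightarrow> g x = x" "\<And>g. g \<in> H \<Longrightarrow> g y = y"
        by (auto simp: fixed_field_def)
      show "x \<otimes> y \<in> fixed_field L H" "x \<oplus> y \<in> fixed_field L H" "\<ominus> x \<in> fixed_field L H"
        using xy(1,2) by (simp_all add: fixed_field_def Gal_ops[OF h] xy(3,4))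
    qed (auto simp: fixed_field_def Gal_ops[OF h])
    fix k assume k: "k \<in> fixed_field L H - {\<zero>}"
    then have kL: "k \<in> carrier L" "k \<noteq> \<zero>" by (auto simp: fixed_field_def)
    then have inv: "inv k \<in> carrier L" "inv k \<otimes> k = \<one>" using field_Units by auto
    have "g (inv k) = inv k" if g: "g \<in> H" for g
    proof -
      have "g k = k" using k g by (auto simp: fixed_field_def)
      then have "g (inv k) \<otimes> k = \<one>"
        using Gal_ops(2)[OF h[OF g] inv(1) kL(1)] inv(2) Gal_ops(3)[OF h[OF g]] by simp
      then have "g (inv k) \<otimes> k = inv k \<otimes> k" using inv by simp
      then show ?thesis
        using m_rcancel[OF kL(2,1) Gal_app[OF h[OF g] inv(1)] inv(1)] by simp
    qed
    then show "inv k \<in> fixed_field L H" using inv by (simp add: fixed_field_def)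
  qed
qed

text \<open>
  Artin's theorem, by independence.  The trace \<open>T = \<Sum>\<^sub>n n\<close> over \<open>N\<close> takes values in the fixed field,
  so an automorphism \<open>g\<close> of \<open>L\<close> over the fixed field satisfies \<open>\<Sum>\<^sub>n gn = \<Sum>\<^sub>n n\<close>.  If \<open>g\<close> were outside
  \<open>N\<close>, then \<open>gN\<close> and \<open>N\<close> would be disjoint and this would be a nontrivial linear relation.
\<close>

lemma Gal_fixed_field:
  assumes NG: "N \<subseteq> G" and one: "\<one>\<^bsub>E\<^esub> \<in> N"
    and mult: "\<And>g h. g \<in> N \<Longrightarrow> h \<in> N \<Longrightarrow> g \<otimes>\<^bsub>E\<^esub> h \<in> N"
    and inv: "\<And>g. g \<in> N \<Longrightarrow> inv\<^bsub>E\<^esub> g \<in> N"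
  shows "Gal L (fixed_field L N) = N"
proof
  show "N \<subseteq> Gal L (fixed_field L N)"
    using NG by (auto simp: Gal_def fixed_field_def)
  have N: "finite N" using finite_subset[OF NG finite_Gal] .
  have app: "n x \<in> carrier L" if "n \<in> N" "x \<in> carrier L" for n x
    using Gal_app[of n K x] that NG by auto
  have translate: "(\<Oplus>n\<in>N. h (n x)) = (\<Oplus>n\<in>(\<lambda>n. h \<otimes>\<^bsub>E\<^esub> n) ` N. n x)"
    if h: "h \<in> G" and x: "x \<in> carrier L" for h x
  proof -
    have "(\<Oplus>n\<in>N. h (n x)) = (\<Oplus>n\<in>N. (h \<otimes>\<^bsub>E\<^esub> n) x)"
      using x app Gal_app[OF h] by (intro finsum_cong') (auto simp: E_ops)
    also have "\<dots> = (\<Oplus>n\<in>(\<lambda>n. h \<otimes>\<^bsub>E\<^esub> n) ` N. n x)"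
      using x app Gal_app[OF h] by (intro finsum_reindex[OF _ inj_on_translate[OF h NG], symmetric]) (auto simp: E_ops)
    finally show ?thesis .
  qed
  show "Gal L (fixed_field L N) \<subseteq> N"
  proof
    fix g assume g: "g \<in> Gal L (fixed_field L N)"
    have K_fix: "K \<subseteq> fixed_field L N" using fixed_field_intermediate[OF NG] by (simp add: intermediate_def)
    have gG: "g \<in> G" using g Gal_mono[OF K_fix] by auto
    show "g \<in> N"
    proof (rule ccontr)
      assume "g \<notin> N"
      let ?gN = "(\<lambda>n. g \<otimes>\<^bsub>E\<^esub> n) ` N"
      have disj: "N \<inter> ?gN = {}"
      proof (rule equals0I)
        fix m assume "m \<in> N \<inter> ?gN"
        then obtain n where n: "n \<in> N" "m = g \<otimes>\<^bsub>E\<^esub> n" "m \<in> N" by auto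
        have nG: "n \<in> G" using n NG by auto
        have "m \<otimes>\<^bsub>E\<^esub> inv\<^bsub>E\<^esub> n = g"
          unfolding n(2) using Gal_in_E[OF gG] Gal_in_E[OF nG] Gal_in_E[OF inv_E_Gal[OF nG]]
          by (simp add: E.m_assoc inv_E_r[OF nG])
        then show False using mult[OF n(3) inv[OF n(1)]] \<open>g \<notin> N\<close> by simp
      qed
      have gN: "?gN \<subseteq> G" using Gal_mult[OF gG _ K_subset] NG by blast
      let ?l = "\<lambda>s. if s \<in> N then \<one> else \<ominus> \<one>"
      have "?l \<one>\<^bsub>E\<^esub> = \<zero>"
      proof (rule Dedekind_independence[where S = "N \<union> ?gN" and l = ?l and g = "\<one>\<^bsub>E\<^esub>"])
        fix x assume x: "x \<in> carrier L"
        let ?T = "\<Oplus>n\<in>N. n x"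
        have T: "?T \<in> carrier L" using app x by auto
        have "h ?T = ?T" if h: "h \<in> N" for h
        proof -
          have hG: "h \<in> G" using h NG by auto
          interpret h: ring_hom_ring L L h by (rule Gal_hom_ring[OF hG])
          have "h ?T = (\<Oplus>n\<in>N. h (n x))"
            using h.hom_finsum[of "\<lambda>n. n x" N] app x by (auto simp: comp_def)
          also have "\<dots> = (\<Oplus>n\<in>(\<lambda>n. h \<otimes>\<^bsub>E\<^esub> n) ` N. n x)" by (rule translate[OF hG x])
          also have "(\<lambda>n. h \<otimes>\<^bsub>E\<^esub> n) ` N = N"
            by (rule translate_image[OF hG NG mult[OF h]])
          finally show ?thesis .
        qed
        then have "?T \<in> fixed_field L N" using T by (simp add: fixed_field_def)
        then have gT: "g ?T = ?T" using Gal_fix[OF g] by auto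
        interpret g: ring_hom_ring L L g by (rule Gal_hom_ring[OF g])
        have "g ?T = (\<Oplus>n\<in>N. g (n x))"
          using g.hom_finsum[of "\<lambda>n. n x" N] app x by (auto simp: comp_def)
        then have T2: "(\<Oplus>n\<in>?gN. n x) = ?T" using translate[OF gG x] gT by simp
        have gNx: "s x \<in> carrier L" if "s \<in> ?gN" for s using that gN Gal_app[of s K x] x by blast
        have sum_N: "(\<Oplus>s\<in>N. ?l s \<otimes> s x) = ?T"
          using app x by (intro finsum_cong') auto
        have "(\<Oplus>s\<in>?gN. ?l s \<otimes> s x) = (\<Oplus>s\<in>?gN. \<ominus> \<one> \<otimes> s x)"
          using disj gNx x by (intro finsum_cong') auto
        also have "\<dots> = \<ominus> \<one> \<otimes> (\<Oplus>s\<in>?gN. s x)"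
          using gNx N by (intro finsum_rdistr[symmetric]) auto
        finally have sum_gN: "(\<Oplus>s\<in>?gN. ?l s \<otimes> s x) = \<ominus> ?T"
          unfolding T2 using T by (simp add: l_minus)
        have "(\<Oplus>s\<in>N \<union> ?gN. ?l s \<otimes> s x) = (\<Oplus>s\<in>N. ?l s \<otimes> s x) \<oplus> (\<Oplus>s\<in>?gN. ?l s \<otimes> s x)"
          using N disj app gNx x by (intro finsum_Un_disjoint) auto
        then show "(\<Oplus>s\<in>N \<union> ?gN. ?l s \<otimes> s x) = \<zero>"
          unfolding sum_N sum_gN using r_neg[OF T] by simp
      qed (use N NG gN one in auto)
      then show False using one by simp
    qed
  qed
qed

text \<open>
  \<open>1\<close> extends to a basis of \<open>L\<close> over \<open>\<Gamma>\<close>; the span \<open>W\<close> of the other basis vectors is a complement of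
  \<open>\<Gamma>\<close>, and \<open>f\<close> is the projection along \<open>W\<close>.
\<close>

lemma linear_projection:
  assumes "intermediate \<Gamma>"
  obtains f where "f \<in> centralizer E (lmult L ` \<Gamma>)" "f \<one> = \<one>" "\<And>x. x \<in> carrier L \<Longrightarrow> f x \<in> \<Gamma>"
proof -
  note \<Gamma> = intermediateD[OF assms]
  obtain n where "dimension n K (carrier L)" using finite_dim by (auto simp: finite_dimension_def)
  then obtain Us where Us: "set Us \<subseteq> carrier L" "Span K Us = carrier L"
    using exists_base[OF subfield_K] by blast
  \<comment> \<open>a basis over \<open>K\<close> still generates \<open>L\<close> over \<open>\<Gamma>\<close>, so \<open>L\<close> has finite dimension over \<open>\<Gamma>\<close>\<close>
  have "Span K Us \<subseteq> Span \<Gamma> Us"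
    unfolding Span_eq_combine_set[OF subfield_K Us(1)] Span_eq_combine_set[OF \<Gamma>(1) Us(1)]
    using \<Gamma>(2) by blast
  then have span: "Span \<Gamma> Us = carrier L"
    using Us Span_subgroup_props(1)[OF \<Gamma>(1) Us(1)] by (simp del: Span.simps)
  obtain Vs where Vs: "independent \<Gamma> Vs" "Span \<Gamma> Vs = carrier L"
    using filter_base[OF \<Gamma>(1) Us(1)] unfolding span by metis
  have dim: "dimension (length Vs) \<Gamma> (carrier L)" using dimensionI[OF \<Gamma>(1) Vs] .
  have "independent \<Gamma> [\<one>]" by (rule li_Cons) (auto intro: li_Nil)
  then obtain Ws where Ws: "independent \<Gamma> (Ws @ [\<one>])" "Span \<Gamma> (Ws @ [\<one>]) = carrier L"
    using complete_base[OF \<Gamma>(1) dim, of "[\<one>]"] by auto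
  define W where "W = Span \<Gamma> Ws"
  have WL: "set Ws \<subseteq> carrier L" using independent_in_carrier[OF Ws(1)] by simp
  have one: "Span \<Gamma> [\<one>] = \<Gamma>"
    using \<Gamma>(3) by (force simp: line_extension_mem_iff)
  have int: "W \<inter> \<Gamma> = {\<zero>}"
    using independent_split(3)[OF \<Gamma>(1) Ws(1)] unfolding one W_def .
  have sum: "carrier L = W <+> \<Gamma>"
    using Span_append_eq_set_add[OF \<Gamma>(1) WL, of "[\<one>]"] Ws(2) unfolding one W_def by simp
  note W = Span_subgroup_props[OF \<Gamma>(1) WL, folded W_def] Span_smult_closed[OF \<Gamma>(1) WL, folded W_def]
  note \<Gamma>cl = subringE[OF \<Gamma>(4)]
  have uniq: "c = d" if cd: "c \<in> \<Gamma>" "d \<in> \<Gamma>" "w \<in> W" "v \<in> W" "w \<oplus> c = v \<oplus> d" for c d v w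
  proof -
    have cl: "c \<in> carrier L" "d \<in> carrier L" "w \<in> carrier L" "v \<in> carrier L"
      using cd W(1) \<Gamma>(3) by auto
    have "w \<oplus> \<ominus> v = (w \<oplus> c) \<oplus> (\<ominus> c \<oplus> \<ominus> v)"
      using cl by algebra
    also have "\<dots> = d \<oplus> \<ominus> c"
      unfolding cd(5) using cl by algebra
    finally have "w \<oplus> \<ominus> v = d \<oplus> \<ominus> c" .
    moreover have "w \<oplus> \<ominus> v \<in> W" using cd W by simp
    moreover have "d \<oplus> \<ominus> c \<in> \<Gamma>" using cd \<Gamma>cl by simp
    ultimately have "d \<oplus> \<ominus> c = \<zero>" using int by auto
    then show ?thesis using cl by (simp add: a_minus_def[symmetric])
  qed
  define f where "f = (\<lambda>x \<in> carrier L. THE c. c \<in> \<Gamma> \<and> (\<exists>w \<in> W. x = w \<oplus> c))"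
  have f_eq: "f (w \<oplus> c) = c" if "w \<in> W" "c \<in> \<Gamma>" for w c
  proof -
    have "w \<oplus> c \<in> carrier L" using that W(1) \<Gamma>(3) by auto
    then show ?thesis
      unfolding f_def using that uniq by (auto intro!: the_equality)
  qed
  have dec: "\<exists>w \<in> W. \<exists>c \<in> \<Gamma>. x = w \<oplus> c" if "x \<in> carrier L" for x
    using that sum by (auto simp: set_add_def')
  have f_smult: "f (k \<otimes> x) = k \<otimes> f x" if k: "k \<in> \<Gamma>" and x: "x \<in> carrier L" for k x
  proof -
    obtain w c where wc: "w \<in> W" "c \<in> \<Gamma>" "x = w \<oplus> c" using dec[OF x] by auto
    have "k \<otimes> x = k \<otimes> w \<oplus> k \<otimes> c"
      using k wc W(1) \<Gamma>(3) by (auto simp: r_distr subset_iff)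
    then show ?thesis
      using f_eq[OF wc(1,2)] f_eq[OF W(5)[OF k wc(1)] \<Gamma>cl(6)[OF k wc(2)]] wc(3) by simp
  qed
  have f_app: "f x \<in> \<Gamma>" if "x \<in> carrier L" for x
    using dec[OF that] f_eq by auto
  have fE: "f \<in> carrier E"
  proof (rule E_I)
    show "f x \<in> carrier L" if "x \<in> carrier L" for x using f_app[OF that] \<Gamma>(3) by auto
    show "f (k \<otimes> x) = k \<otimes> f x" if "k \<in> K" "x \<in> carrier L" for k x
      using f_smult that \<Gamma>(2) by auto
    fix x y assume "x \<in> carrier L" "y \<in> carrier L"
    then obtain w c v d where wc: "w \<in> W" "c \<in> \<Gamma>" "x = w \<oplus> c" "v \<in> W" "d \<in> \<Gamma>" "y = v \<oplus> d"
      using dec by metis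
    have "x \<oplus> y = (w \<oplus> v) \<oplus> (c \<oplus> d)"
      unfolding wc(3,6) using wc W(1) \<Gamma>(3) by (auto simp: a_ac subset_iff)
    then show "f (x \<oplus> y) = f x \<oplus> f y"
      using f_eq[OF wc(1,2)] f_eq[OF wc(4,5)] f_eq[OF W(3)[OF wc(1,4)] \<Gamma>cl(7)[OF wc(2,5)]]
      by (simp add: wc(3,6))
  qed (simp add: f_def)
  show thesis
  proof
    show "f \<in> centralizer E (lmult L ` \<Gamma>)"
      using fE f_smult commutes_lmult_iff[OF fE] \<Gamma>(3) by (auto simp: centralizer_def)
    show "f \<one> = \<one>" using f_eq[OF W(2) \<Gamma>cl(3)] by simp
  qed (rule f_app)
qed

end

section \<open>Subalgebras containing \<open>L\<close>\<close>

locale G_generated_extension = finite_field_extension +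
  assumes E_generated: "carrier E = skew L K G"
begin

text \<open>
  Every element of \<open>A\<close> is a sum \<open>\<Sum> l\<^sub>g g\<close> over \<open>G\<close>, and the automorphisms that really occur in it
  already belong to \<open>A\<close>.
\<close>

lemma subalgebra_eq_skew:
  assumes A: "is_subalgebra L K A" and LA: "lmult L ` carrier L \<subseteq> A"
  shows "A = skew L K (A \<inter> G)"
proof
  show "skew L K (A \<inter> G) \<subseteq> A" by (rule skew_subalgebra(4)[OF _ A LA]) auto
  note S = skew_subalgebra[of "A \<inter> G", OF Int_lower2] subalgebraD[OF skew_subalgebra(1)[of "A \<inter> G", OF Int_lower2]]
  note A' = subalgebraD[OF A]
  have lA: "lmult L l \<in> A" if "l \<in> carrier L" for l using LA that by auto
  show "A \<subseteq> skew L K (A \<inter> G)"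
  proof
    fix a assume a: "a \<in> A"
    then have "a \<in> skew L K G" using A'(1) E_generated by auto
    then obtain l where l: "l \<in> G \<rightarrow> carrier L" "\<And>x. x \<in> carrier L \<Longrightarrow> a x = (\<Oplus>g\<in>G. l g \<otimes> g x)"
      by (rule skew_sum) blast
    have lg: "l g = \<zero>" if "g \<in> G" "g \<notin> A" for g
    proof (rule ccontr)
      assume "l g \<noteq> \<zero>"
      then have "g \<in> A"
        by (intro automorphism_in_bimodule[OF A'(1) A'(6) A'(4)[OF lA] A'(4)[OF _ lA]
            finite_Gal order_refl l(1) that(1) _ a l(2)])
      then show False using that by simp
    qed
    have summand: "lmult L (l g) \<otimes>\<^bsub>E\<^esub> g \<in> skew L K (A \<inter> G)" if "g \<in> G" for g
    proof (cases "g \<in> A")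
      case True
      then show ?thesis using that S(2,3) l(1) by (intro S(8)) auto
    next
      case False
      have "lmult L \<zero> \<otimes>\<^bsub>E\<^esub> g = \<zero>\<^bsub>E\<^esub>"
        using Gal_app[OF that] Gal_in_E[OF that]
        by (intro E_eqI) (auto simp: E_ops lmult_app lmult_closed)
      moreover have "\<zero>\<^bsub>E\<^esub> \<in> skew L K (A \<inter> G)" using S(10)[OF S(6) S(6)] by (simp add: a_minus_def E.r_neg)
      ultimately show ?thesis using lg[OF that False] by simp
    qed
    have partial: "\<exists>b \<in> skew L K (A \<inter> G). \<forall>x \<in> carrier L. b x = (\<Oplus>g\<in>F. l g \<otimes> g x)"
      if "finite F" "F \<subseteq> G" for F
      using that
    proof (induction F)
      case empty
      have "\<zero>\<^bsub>E\<^esub> \<in> skew L K (A \<inter> G)" using S(10)[OF S(6) S(6)] by (simp add: a_minus_def E.r_neg)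
      then show ?case by (intro bexI[of _ "\<zero>\<^bsub>E\<^esub>"]) (simp_all add: E_ops)
    next
      case (insert h F)
      then obtain b where b: "b \<in> skew L K (A \<inter> G)" "\<forall>x \<in> carrier L. b x = (\<Oplus>g\<in>F. l g \<otimes> g x)"
        by auto
      have hG: "h \<in> G" using insert.prems by auto
      show ?case
      proof (intro bexI ballI)
        show "lmult L (l h) \<otimes>\<^bsub>E\<^esub> h \<oplus>\<^bsub>E\<^esub> b \<in> skew L K (A \<inter> G)"
          by (rule S(7)[OF summand[OF hG] b(1)])
        fix x assume x: "x \<in> carrier L"
        have cl: "l g \<otimes> g x \<in> carrier L" if "g \<in> insert h F" for g
          using that insert.prems l(1) Gal_app[of g K x] x by (auto simp: subset_iff)
        show "(lmult L (l h) \<otimes>\<^bsub>E\<^esub> h \<oplus>\<^bsub>E\<^esub> b) x = (\<Oplus>g\<in>insert h F. l g \<otimes> g x)"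
          using insert.hyps cl b(2) x Gal_app[OF hG x]
          by (subst finsum_insert) (auto simp: E_ops lmult_app)
      qed
    qed
    obtain b where b: "b \<in> skew L K (A \<inter> G)" "\<And>x. x \<in> carrier L \<Longrightarrow> b x = (\<Oplus>g\<in>G. l g \<otimes> g x)"
      using partial[OF finite_Gal order_refl] by auto
    have "a = b"
      using subsetD[OF A'(1) a] subsetD[OF S(5) b(1)] by (rule E_eqI) (simp add: b(2) l(2))
    then show "a \<in> skew L K (A \<inter> G)" using b(1) by simp
  qed
qed

end

context G_generated_extension begin

text \<open>
  \<open>C\<^sub>E(\<Gamma>)\<close> is a subalgebra containing \<open>L\<close>, and the automorphisms commuting with \<open>\<Gamma>\<close> are those fixing
  it pointwise.
\<close>

lemma centralizer_eq_skew:
  assumes "intermediate \<Gamma>"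
  shows "centralizer E (lmult L ` \<Gamma>) = skew L K (Gal L \<Gamma>)"
  using subalgebra_eq_skew[OF centralizer_intermediate[OF intermediateD(3)[OF assms]]]
  unfolding centralizer_Int_Gal[OF intermediateD(3,2)[OF assms]] .

lemma skew_commutes_fixed_field:
  assumes H: "H \<subseteq> G" and l: "l \<in> fixed_field L H" and a: "a \<in> skew L K H"
  shows "a \<otimes>\<^bsub>E\<^esub> lmult L l = lmult L l \<otimes>\<^bsub>E\<^esub> a"
proof -
  have lL: "l \<in> carrier L" using l by (simp add: fixed_field_def)
  have "is_subalgebra L K (centralizer E (lmult L ` {l}))"
    "lmult L ` carrier L \<subseteq> centralizer E (lmult L ` {l})"
    using lL by (intro centralizer_intermediate; simp)+
  moreover have "H \<subseteq> centralizer E (lmult L ` {l})"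
  proof
    fix g assume g: "g \<in> H"
    then have gG: "g \<in> G" using H by auto
    then show "g \<in> centralizer E (lmult L ` {l})"
      using Gal_commutes_lmult_iff[OF gG lL] Gal_in_E[OF gG] g l
      by (simp add: centralizer_def fixed_field_def)
  qed
  ultimately have "skew L K H \<subseteq> centralizer E (lmult L ` {l})"
    by (rule skew_subalgebra(4)[OF H])
  then show ?thesis using a by (auto simp: centralizer_def)
qed

text \<open>
  Let \<open>l\<close> be fixed by \<open>G(L/\<Gamma>)\<close>.  Then \<open>l\<close> commutes with \<open>C\<^sub>E(\<Gamma>) = L \<rtimes> G(L/\<Gamma>)\<close>, hence with a
  projection \<open>f\<close> onto \<open>\<Gamma>\<close>, and \<open>l = l f(1) = f(l) \<in> \<Gamma>\<close>.
\<close>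

lemma fixed_field_Gal:
  assumes \<Gamma>: "intermediate \<Gamma>"
  shows "fixed_field L (Gal L \<Gamma>) = \<Gamma>"
proof
  note \<Gamma>' = intermediateD[OF \<Gamma>]
  show "\<Gamma> \<subseteq> fixed_field L (Gal L \<Gamma>)"
    using \<Gamma>'(3) by (auto simp: fixed_field_def Gal_fix)
  show "fixed_field L (Gal L \<Gamma>) \<subseteq> \<Gamma>"
  proof
    fix l assume l: "l \<in> fixed_field L (Gal L \<Gamma>)"
    then have lL: "l \<in> carrier L" by (simp add: fixed_field_def)
    from linear_projection[OF \<Gamma>] obtain f where
      f: "f \<in> centralizer E (lmult L ` \<Gamma>)" "f \<one> = \<one>" "\<And>x. x \<in> carrier L \<Longrightarrow> f x \<in> \<Gamma>" by metis
    then have "f \<otimes>\<^bsub>E\<^esub> lmult L l = lmult L l \<otimes>\<^bsub>E\<^esub> f"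
      using skew_commutes_fixed_field[OF Gal_mono[OF \<Gamma>'(2)] l] centralizer_eq_skew[OF \<Gamma>] by simp
    moreover have "f \<in> carrier E" using f(1) by (simp add: centralizer_def)
    ultimately have "f (l \<otimes> \<one>) = l \<otimes> f \<one>" using commutes_lmult_iff lL by blast
    then have "f l = l" using lL f(2) by simp
    with f(3)[OF lL] show "l \<in> \<Gamma>" by simp
  qed
qed

lemma Int_Gal_inv:
  assumes A: "is_subalgebra L K A" and g: "g \<in> A \<inter> G"
  shows "inv\<^bsub>E\<^esub> g \<in> A"
proof -
  have gG: "g \<in> G" using g by simp
  have "(\<lambda>h. g \<otimes>\<^bsub>E\<^esub> h) ` (A \<inter> G) = A \<inter> G"
    using subalgebraD(4)[OF A] Gal_mult[OF gG _ K_subset] g by (intro translate_image[OF gG]) auto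
  moreover have "\<one>\<^bsub>E\<^esub> \<in> A \<inter> G" using subalgebraD(2)[OF A] Gal_one[OF K_subset] by auto
  ultimately obtain h where h: "h \<in> A \<inter> G" "g \<otimes>\<^bsub>E\<^esub> h = \<one>\<^bsub>E\<^esub>" by (metis imageE)
  then have "h = inv\<^bsub>E\<^esub> g"
    using inv_E_cancel[OF gG, of h] Gal_in_E[of h] Gal_in_E[OF inv_E_Gal[OF gG]] by simp
  then show ?thesis using h by auto
qed

text \<open>
  \<open>A \<inter> G\<close> is closed under multiplication, and a subgroup because \<open>G\<close> is finite.
\<close>

lemma Gal_fixed_field_Int:
  assumes A: "is_subalgebra L K A"
  shows "Gal L (fixed_field L (A \<inter> G)) = A \<inter> G"
  by (rule Gal_fixed_field)
    (use subalgebraD[OF A] Gal_mult Gal_one K_subset inv_E_Gal Int_Gal_inv[OF A] in auto)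

text \<open>
  An endomorphism \<open>c\<close> commuting with \<open>L\<close> is multiplication by \<open>c(1)\<close>, and it commutes with an
  automorphism exactly when \<open>c(1)\<close> is fixed by it.
\<close>

lemma centralizer_of_subalgebra:
  assumes A: "is_subalgebra L K A" and LA: "lmult L ` carrier L \<subseteq> A"
  shows "centralizer E A = lmult L ` fixed_field L (A \<inter> G)"
proof
  show "lmult L ` fixed_field L (A \<inter> G) \<subseteq> centralizer E A"
  proof safe
    fix l assume l: "l \<in> fixed_field L (A \<inter> G)"
    have "l \<in> carrier L" using l by (simp add: fixed_field_def)
    moreover have "a \<otimes>\<^bsub>E\<^esub> lmult L l = lmult L l \<otimes>\<^bsub>E\<^esub> a" if "a \<in> A" for a
      using skew_commutes_fixed_field[OF Int_lower2 l] subalgebra_eq_skew[OF A LA] that by auto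
    ultimately show "lmult L l \<in> centralizer E A" by (simp add: centralizer_def lmult_closed)
  qed
  show "centralizer E A \<subseteq> lmult L ` fixed_field L (A \<inter> G)"
  proof
    fix c assume c: "c \<in> centralizer E A"
    then have cE: "c \<in> carrier E" by (simp add: centralizer_def)
    have c1: "c \<one> \<in> carrier L" using E_app[OF cE] by simp
    have eq: "c = lmult L (c \<one>)"
    proof (rule E_eqI[OF cE lmult_closed[OF c1]])
      fix x assume x: "x \<in> carrier L"
      have "c \<otimes>\<^bsub>E\<^esub> lmult L x = lmult L x \<otimes>\<^bsub>E\<^esub> c" using c LA x by (auto simp: centralizer_def)
      then have "c (x \<otimes> \<one>) = x \<otimes> c \<one>" using commutes_lmult_iff[OF cE x] by blast
      then show "c x = lmult L (c \<one>) x" using x c1 by (simp add: lmult_app m_comm)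
    qed
    have "g (c \<one>) = c \<one>" if "g \<in> A \<inter> G" for g
    proof -
      have "c \<otimes>\<^bsub>E\<^esub> g = g \<otimes>\<^bsub>E\<^esub> c" using c that by (auto simp: centralizer_def)
      then have "g \<otimes>\<^bsub>E\<^esub> lmult L (c \<one>) = lmult L (c \<one>) \<otimes>\<^bsub>E\<^esub> g" using eq by simp
      then show ?thesis using Gal_commutes_lmult_iff[OF _ c1] that by blast
    qed
    then have "c \<one> \<in> fixed_field L (A \<inter> G)" using c1 by (simp add: fixed_field_def)
    then show "c \<in> lmult L ` fixed_field L (A \<inter> G)" using eq by (rule rev_image_eqI)
  qed
qed

lemma double_centralizer:
  assumes A: "is_subalgebra L K A" and LA: "lmult L ` carrier L \<subseteq> A"
  shows "centralizer E (lmult L ` fixed_field L (A \<inter> G)) = A"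
  using centralizer_eq_skew[OF fixed_field_intermediate[of "A \<inter> G"]] subalgebra_eq_skew[OF A LA]
  by (simp add: Gal_fixed_field_Int[OF A])

lemma normal_subgroup_iff:
  "N \<in> normal_subgroups (Gal_group L K) \<longleftrightarrow> N \<subseteq> G \<and> \<one>\<^bsub>E\<^esub> \<in> N \<and>
    (\<forall>g \<in> N. \<forall>h \<in> N. g \<otimes>\<^bsub>E\<^esub> h \<in> N) \<and> (\<forall>g \<in> N. inv\<^bsub>E\<^esub> g \<in> N) \<and>
    (\<forall>g \<in> G. \<forall>h \<in> N. g \<otimes>\<^bsub>E\<^esub> h \<otimes>\<^bsub>E\<^esub> inv\<^bsub>E\<^esub> g \<in> N)" (is "_ \<longleftrightarrow> ?R")
proof -
  have conj: "g \<otimes>\<^bsub>Gal_group L K\<^esub> h \<otimes>\<^bsub>Gal_group L K\<^esub> inv\<^bsub>Gal_group L K\<^esub> g = g \<otimes>\<^bsub>E\<^esub> h \<otimes>\<^bsub>E\<^esub> inv\<^bsub>E\<^esub> g"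
    if "g \<in> G" "h \<in> G" for g h
    using that by (simp add: Gal_group_ops Gal_group_inv inv_E_Gal Gal_mult[OF _ _ K_subset])
  have sub: "subgroup N (Gal_group L K) \<longleftrightarrow> N \<subseteq> G \<and> \<one>\<^bsub>E\<^esub> \<in> N \<and>
      (\<forall>g \<in> N. \<forall>h \<in> N. g \<otimes>\<^bsub>E\<^esub> h \<in> N) \<and> (\<forall>g \<in> N. inv\<^bsub>E\<^esub> g \<in> N)"
  proof (cases "N \<subseteq> G")
    case True
    then have "\<And>g h. g \<in> N \<Longrightarrow> h \<in> N \<Longrightarrow> g \<otimes>\<^bsub>Gal_group L K\<^esub> h = g \<otimes>\<^bsub>E\<^esub> h"
      "\<And>g. g \<in> N \<Longrightarrow> inv\<^bsub>Gal_group L K\<^esub> g = inv\<^bsub>E\<^esub> g"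
      using Gal_group_ops Gal_group_inv by blast+
    then show ?thesis by (simp add: subgroup_def Gal_group_carrier Gal_group_one) blast
  qed (simp add: subgroup_def Gal_group_carrier)
  show ?thesis
    unfolding normal_subgroups_def mem_Collect_eq G.normal_inv_iff sub Gal_group_carrier
    using conj by (auto simp: subset_iff)
qed

lemma invariant_subalgebraD:
  assumes "A \<in> invariant_subalgebras L K"
  shows "is_subalgebra L K A" "lmult L ` carrier L \<subseteq> A"
    "\<And>g a. g \<in> G \<Longrightarrow> a \<in> A \<Longrightarrow> g \<otimes>\<^bsub>E\<^esub> a \<otimes>\<^bsub>E\<^esub> inv\<^bsub>E\<^esub> g \<in> A"
  using assms by (auto simp: invariant_subalgebras_def)

lemma Int_Gal_normal:
  assumes "A \<in> invariant_subalgebras L K"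
  shows "A \<inter> G \<in> normal_subgroups (Gal_group L K)"
proof -
  note A = invariant_subalgebraD[OF assms]
  have "g \<otimes>\<^bsub>E\<^esub> h \<otimes>\<^bsub>E\<^esub> inv\<^bsub>E\<^esub> g \<in> G" if "g \<in> G" "h \<in> G" for g h
    using that by (intro Gal_mult[OF _ _ K_subset] inv_E_Gal)
  then show ?thesis
    unfolding normal_subgroup_iff
    using subalgebraD(2,4)[OF A(1)] Int_Gal_inv[OF A(1)] A(3) Gal_mult[OF _ _ K_subset] Gal_one[OF K_subset]
      inv_E_Gal by auto
qed

text \<open>
  Conjugation by \<open>g\<close> carries the centralizer of \<open>\<Gamma>\<close> to that of \<open>g(\<Gamma>)\<close>.
\<close>

lemma stable_imp_invariant:
  assumes \<Gamma>: "intermediate \<Gamma>" and stable: "\<And>g x. g \<in> G \<Longrightarrow> x \<in> \<Gamma> \<Longrightarrow> g x \<in> \<Gamma>"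
  shows "centralizer E (lmult L ` \<Gamma>) \<in> invariant_subalgebras L K"
proof -
  note \<Gamma>' = intermediateD[OF \<Gamma>]
  have "g \<otimes>\<^bsub>E\<^esub> a \<otimes>\<^bsub>E\<^esub> inv\<^bsub>E\<^esub> g \<in> centralizer E (lmult L ` \<Gamma>)"
    if g: "g \<in> G" and a: "a \<in> centralizer E (lmult L ` \<Gamma>)" for g a
  proof -
    have E: "a \<in> carrier E" "g \<in> carrier E" "inv\<^bsub>E\<^esub> g \<in> carrier E"
      using a Gal_in_E[OF g] Gal_in_E[OF inv_E_Gal[OF g]] by (auto simp: centralizer_def)
    then have cE: "g \<otimes>\<^bsub>E\<^esub> a \<otimes>\<^bsub>E\<^esub> inv\<^bsub>E\<^esub> g \<in> carrier E" by auto
    have "(g \<otimes>\<^bsub>E\<^esub> a \<otimes>\<^bsub>E\<^esub> inv\<^bsub>E\<^esub> g) (c \<otimes> x) = c \<otimes> (g \<otimes>\<^bsub>E\<^esub> a \<otimes>\<^bsub>E\<^esub> inv\<^bsub>E\<^esub> g) x"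
      if c: "c \<in> \<Gamma>" and x: "x \<in> carrier L" for c x
    proof -
      let ?i = "inv\<^bsub>E\<^esub> g"
      have cL: "c \<in> carrier L" using c \<Gamma>'(3) by auto
      have i: "?i \<in> G" by (rule inv_E_Gal[OF g])
      have ic: "?i c \<in> \<Gamma>" by (rule stable[OF i c])
      note cl = Gal_app[OF i cL] Gal_app[OF i x] E_app[OF E(1) Gal_app[OF i x]]
      have "a (?i c \<otimes> ?i x) = ?i c \<otimes> a (?i x)"
        using a ic commutes_lmult_iff[OF E(1) cl(1)] cl(2) by (auto simp: centralizer_def)
      then have "g (a (?i (c \<otimes> x))) = c \<otimes> g (a (?i x))"
        using Gal_ops(2)[OF i cL x] Gal_ops(2)[OF g cl(1,3)] inv_E_app(2)[OF g cL] by simp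
      then show ?thesis
        using x cL Gal_app[OF i x] Gal_app[OF i m_closed[OF cL x]] by (simp add: E_ops)
    qed
    then show ?thesis
      using cE commutes_lmult_iff[OF cE] \<Gamma>'(3) by (auto simp: centralizer_def)
  qed
  then show ?thesis
    using centralizer_intermediate[OF \<Gamma>'(3)] by (auto simp: invariant_subalgebras_def)
qed

end

section \<open>Orbits and minimal polynomials\<close>

text \<open>
  A polynomial with as many distinct roots as its degree has no further roots and no multiple ones.
  This is the common source of normality and of separability below.
\<close>

lemma (in field) roots_eq_mset_set:
  assumes p: "p \<in> carrier (poly_ring R)" and S: "finite S" "\<And>y. y \<in> S \<Longrightarrow> is_root p y"
    and deg: "degree p \<le> card S"
  shows "roots p = mset_set S"
proof -
  have "mset_set S \<subseteq># roots p"
  proof (rule mset_subset_eqI)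
    fix y
    have "count (roots p) y > 0" if "y \<in> S"
      using S(2)[OF that] roots_mem_iff_is_root[OF p] by simp
    then show "count (mset_set S) y \<le> count (roots p) y"
      using S(1) by (cases "y \<in> S") (auto simp: Suc_le_eq)
  qed
  moreover have "size (roots p) \<le> size (mset_set S)"
    using size_roots_le_degree[OF p] deg S(1) by simp
  ultimately show ?thesis
    using mset_subset_size by (metis leD subset_mset.le_imp_less_or_eq)
qed

definition (in ring) root_poly :: "'a set \<Rightarrow> 'a list" where
  "root_poly S = (\<Otimes>\<^bsub>poly_ring R\<^esub>y\<in>S. [\<one>, \<ominus> y])"

text \<open>
  One induction gives all properties of \<open>\<Prod>\<^sub>y (X - y)\<close>.  The last one, that a ring endomorphism permutes
  the factors, is what puts the coefficients of an orbit polynomial into the fixed field.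
\<close>

lemma (in field) root_poly_props:
  assumes "finite S" "S \<subseteq> carrier R"
  shows "root_poly S \<in> carrier (poly_ring R) \<and> root_poly S \<noteq> [] \<and> degree (root_poly S) = card S \<and>
    (\<forall>x \<in> S. eval (root_poly S) x = \<zero>) \<and>
    (\<forall>g \<in> ring_hom R R. inj_on g S \<longrightarrow> map g (root_poly S) = root_poly (g ` S))"
  using assms
proof (induction S)
  case empty
  interpret P: domain "poly_ring R" using univ_poly_is_domain[OF carrier_is_subring] .
  show ?case
    using P.one_closed by (auto simp: root_poly_def univ_poly_one ring_hom_one)
next
  case (insert y S)
  interpret P: domain "poly_ring R" using univ_poly_is_domain[OF carrier_is_subring] .
  have lin: "[\<one>, \<ominus> z] \<in> carrier (poly_ring R)" if "z \<in> carrier R" for z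
    using that by (simp add: polynomial_def flip: univ_poly_carrier)
  have y: "y \<in> carrier R" "S \<subseteq> carrier R" using insert.prems by auto
  note IH = insert.IH[OF y(2)]
  let ?q = "root_poly S"
  have q: "?q \<in> carrier (poly_ring R)" "?q \<noteq> []" "degree ?q = card S"
    using IH by auto
  have ins: "root_poly (insert z T) = poly_mult [\<one>, \<ominus> z] (root_poly T)"
    if "finite T" "z \<notin> T" "insert z T \<subseteq> carrier R" for z T
    using that lin unfolding root_poly_def
    by (subst P.finprod_insert) (auto simp: univ_poly_mult Pi_iff subset_iff)
  note eq = ins[OF insert.hyps insert.prems]
  have set_q: "set ?q \<subseteq> carrier R" using q(1) by (auto simp: polynomial_def simp flip: univ_poly_carrier)
  have closed: "root_poly (insert y S) \<in> carrier (poly_ring R)"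
    unfolding eq using P.m_closed[OF lin[OF y(1)] q(1)] by (simp add: univ_poly_mult)
  have polys: "polynomial (carrier R) [\<one>, \<ominus> y]" "polynomial (carrier R) ?q"
    using lin[OF y(1)] q(1) by (simp_all add: univ_poly_carrier)
  have nz: "root_poly (insert y S) \<noteq> []"
    using poly_mult_integral[OF carrier_is_subring polys] q(2) unfolding eq by auto
  have deg: "degree (root_poly (insert y S)) = card (insert y S)"
  proof -
    have "degree (poly_mult [\<one>, \<ominus> y] ?q) = degree [\<one>, \<ominus> y] + degree ?q"
      unfolding poly_mult_degree_eq[OF carrier_is_subring polys] using q(2) by simp
    then show ?thesis
      unfolding eq q(3) using insert.hyps by (simp del: poly_mult.simps)
  qed
  have root: "eval (root_poly (insert y S)) x = \<zero>" if x: "x \<in> insert y S" for x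
  proof -
    have xR: "x \<in> carrier R" using x insert.prems by auto
    have "eval (root_poly (insert y S)) x = eval [\<one>, \<ominus> y] x \<otimes> eval ?q x"
      unfolding eq using eval_poly_mult[OF _ set_q xR, of "[\<one>, \<ominus> y]"] y(1) by simp
    moreover have "eval [\<one>, \<ominus> y] x = x \<ominus> y" using xR y(1) by (simp add: a_minus_def)
    ultimately show ?thesis
      using x IH xR y(1) eval_in_carrier[OF set_q xR] by (auto simp: r_neg a_minus_def)
  qed
  have hom: "map g (root_poly (insert y S)) = root_poly (g ` insert y S)"
    if g: "g \<in> ring_hom R R" and inj: "inj_on g (insert y S)" for g
  proof -
    interpret g: ring_hom_ring R R g using ring_hom_ringI2[OF ring_axioms ring_axioms g] .
    have cl: "map g (root_poly (insert y S)) \<in> carrier (poly_ring R)"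
      by (rule polynomial_hom[OF g field_axioms field_axioms closed])
    have "map g (root_poly (insert y S)) = normalize (map g (root_poly (insert y S)))"
      using normalize_polynomial cl by (simp add: univ_poly_carrier)
    also have "\<dots> = poly_mult (map g [\<one>, \<ominus> y]) (map g ?q)"
      unfolding eq using y(1) set_q by (intro g.poly_mult_hom') auto
    also have "map g [\<one>, \<ominus> y] = [\<one>, \<ominus> (g y)]" using y(1) by simp
    also have "map g ?q = root_poly (g ` S)" using IH g inj by auto
    also have "poly_mult [\<one>, \<ominus> (g y)] (root_poly (g ` S)) = root_poly (g ` insert y S)"
      using insert.hyps insert.prems inj g.hom_closed by (subst image_insert, subst ins) auto
    finally show ?thesis .
  qed
  show ?case using closed nz deg root hom by blast
qed

context G_generated_extension begin

lemma intermediate_K: "intermediate K"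
  using subfield_K by (simp add: intermediate_def)

lemma fixed_field_G: "fixed_field L G = K"
  by (rule fixed_field_Gal[OF intermediate_K])

lemma coeffs_subset: "p \<in> carrier (M[X]) \<Longrightarrow> set p \<subseteq> M"
  by (auto simp: polynomial_def simp flip: univ_poly_carrier)

lemma eval_conjugate:
  assumes p: "p \<in> carrier (K[X])" and x: "x \<in> carrier L" "eval p x = \<zero>" and g: "g \<in> G"
  shows "eval p (g x) = \<zero>"
proof -
  interpret g: ring_hom_ring L L g by (rule Gal_hom_ring[OF g])
  have "map g p = p" using coeffs_subset[OF p] by (intro map_idI) (auto simp: Gal_fix[OF g])
  then show ?thesis
    using g.eval_hom[OF subfieldE(1)[OF subfield_K] x(1) p] x(2) by (simp add: Gal_ops[OF g])
qed

abbreviation orbit :: "'a \<Rightarrow> 'a set" where "orbit x \<equiv> (\<lambda>g. g x) ` G"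

lemma orbit: "finite (orbit x)" "x \<in> carrier L \<Longrightarrow> orbit x \<subseteq> carrier L" "x \<in> carrier L \<Longrightarrow> x \<in> orbit x"
proof -
  show "x \<in> carrier L \<Longrightarrow> x \<in> orbit x"
    using Gal_one[OF K_subset] by (intro image_eqI[of _ _ "\<one>\<^bsub>E\<^esub>"]) (simp_all add: E_ops)
qed (auto simp: finite_Gal Gal_app)

lemma Gal_orbit:
  assumes g: "g \<in> G" and x: "x \<in> carrier L"
  shows "g ` orbit x = orbit x"
proof -
  have "g ` orbit x \<subseteq> orbit x"
  proof safe
    fix h assume h: "h \<in> G"
    then show "g (h x) \<in> orbit x"
      using Gal_mult[OF g h K_subset] x by (intro image_eqI[of _ _ "g \<otimes>\<^bsub>E\<^esub> h"]) (simp_all add: E_ops)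
  qed
  then show ?thesis
    using orbit(1) inj_on_subset[OF Gal_inj[OF g] orbit(2)[OF x]] by (intro endo_inj_surj)
qed

text \<open>
  Each \<open>g \<in> G\<close> permutes the orbit, so it fixes the coefficients, which therefore lie in \<open>L\<^sup>G = K\<close>.
\<close>

lemma root_poly_orbit:
  assumes x: "x \<in> carrier L"
  shows "root_poly (orbit x) \<in> carrier (K[X])"
proof -
  note rp = root_poly_props[OF orbit(1) orbit(2)[OF x]]
  let ?f = "root_poly (orbit x)"
  have f: "?f \<in> carrier (poly_ring L)" "?f \<noteq> []" using rp by auto
  have "set ?f \<subseteq> fixed_field L G"
  proof
    fix c assume c: "c \<in> set ?f"
    have "g c = c" if g: "g \<in> G" for g
    proof -
      have "map g ?f = ?f"
        using rp Gal_hom[OF g] inj_on_subset[OF Gal_inj[OF g] orbit(2)[OF x]] Gal_orbit[OF g x] by auto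
      then have "map g ?f = map id ?f" by simp
      then show "g c = c" using c unfolding map_eq_conv by simp
    qed
    then show "c \<in> fixed_field L G" using coeffs_subset[OF f(1)] c by (auto simp: fixed_field_def)
  qed
  then show ?thesis
    using f by (auto simp: fixed_field_G polynomial_def simp flip: univ_poly_carrier)
qed

lemma all_algebraic: "x \<in> carrier L \<Longrightarrow> (algebraic over K) x"
  by (rule finite_dimension_imp_algebraic[OF subfield_K carrier_is_subring finite_dim])

text \<open>
  \<open>p\<close> is associated to the minimal polynomial of \<open>x\<close> over \<open>K\<close>, which divides the orbit polynomial.
\<close>

lemma degree_le_orbit:
  assumes p: "p \<in> carrier (K[X])" "pirreducible K p" and x: "x \<in> carrier L" "eval p x = \<zero>"
  shows "degree p \<le> card (orbit x)"
proof -
  let ?f = "root_poly (orbit x)"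
  note sub = subfieldE(1)[OF subfield_K]
  have f: "?f \<in> carrier (K[X])" "?f \<noteq> []" "degree ?f = card (orbit x)" "eval ?f x = \<zero>"
    using root_poly_orbit[OF x(1)] root_poly_props[OF orbit(1) orbit(2)[OF x(1)]] orbit(3)[OF x(1)] by auto
  note q = IrrE[OF subfield_K x(1) all_algebraic[OF x(1)]]
  note min = Irr_minimal[OF subfield_K x(1) all_algebraic[OF x(1)]]
  have "Irr K x divides\<^bsub>K[X]\<^esub> p"
    using min[OF p(1) x(2)] pdivides_iff_shell[OF subfield_K q(1) p(1)] by simp
  then have "Irr K x \<sim>\<^bsub>K[X]\<^esub> p"
    using divides_pirreducible_condition[OF p(2) q(1)] pirreducibleE(2)[OF sub q(1,2)] by auto
  then have "p pdivides Irr K x"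
    using pdivides_iff_shell[OF subfield_K p(1) q(1)] by (simp add: associated_def)
  then have "degree p \<le> degree (Irr K x)"
    using pdivides_imp_degree_le[OF sub p(1) q(1) pirreducibleE(1)[OF sub q(1,2)]] by simp
  also have "\<dots> \<le> degree ?f"
    using pdivides_imp_degree_le[OF sub q(1) f(1,2) min[OF f(1,4)]] .
  finally show ?thesis using f(3) by simp
qed

section \<open>Galois subfields are the stable intermediate fields\<close>

text \<open>
  For \<open>x \<in> \<Gamma>\<close> and \<open>p\<close> irreducible over \<open>K\<close> with \<open>p(x) = 0\<close>, all conjugates of \<open>x\<close> are roots of \<open>p\<close> in
  \<open>\<Gamma>\<close>, and there are at least as many of them as the degree of \<open>p\<close> (\<open>degree_le_orbit\<close>).  So the roots
  of \<open>p\<close> are exactly these conjugates, each simple; over \<open>\<Gamma>\<close> this says that \<open>p\<close> splits, and over the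
  algebraic closure, applied to the images of the conjugates, that \<open>p\<close> is separable.
\<close>

lemma stable_imp_galois:
  assumes \<Gamma>: "intermediate \<Gamma>" and stable: "\<And>g x. g \<in> G \<Longrightarrow> x \<in> \<Gamma> \<Longrightarrow> g x \<in> \<Gamma>"
  shows "\<Gamma> \<in> galois_subfields L K"
proof -
  note \<Gamma>' = intermediateD[OF \<Gamma>]
  let ?F = "L\<lparr>carrier := \<Gamma>\<rparr>"
  interpret F: field ?F by (rule subfield_iff(2)[OF \<Gamma>'(1)])
  have KF: "subfield K ?F"
    using subfield_iff(2)[OF subfield_K] \<Gamma>'(2) by (intro F.subfield_iff(1)) simp_all
  have univ: "univ_poly ?F = univ_poly L" by (rule univ_poly_consistent[OF \<Gamma>'(4)])
  have ev: "F.eval = eval" by (rule eval_consistent[OF \<Gamma>'(4)])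
  have alg: "(F.algebraic over K) x" if "x \<in> \<Gamma>" for x
    using all_algebraic[of x] algebraic_consistent[OF \<Gamma>'(4)] that \<Gamma>'(3) by auto
  have in_F: "p \<in> carrier (poly_ring ?F)" if "p \<in> carrier (K[X])" for p
    using that F.carrier_polynomial_shell[OF subfieldE(1)[OF KF]] by (simp add: univ)
  have orb: "orbit x \<subseteq> \<Gamma>" if "x \<in> \<Gamma>" for x using stable that by auto
  have deg: "degree p \<le> card (orbit x)" and conj_root: "y \<in> orbit x \<Longrightarrow> F.is_root p y"
    if p: "p \<in> carrier (K[X]\<^bsub>?F\<^esub>)" "pirreducible\<^bsub>?F\<^esub> K p" and x: "x \<in> \<Gamma>" "F.eval p x = \<zero>" for p x y
  proof -
    have p': "p \<in> carrier (K[X])" "pirreducible K p" "x \<in> carrier L" "eval p x = \<zero>"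
      using p x \<Gamma>'(3) by (auto simp: univ ev)
    show "degree p \<le> card (orbit x)" by (rule degree_le_orbit[OF p'])
    have "p \<noteq> []" by (rule pirreducibleE(1)[OF subfieldE(1)[OF subfield_K] p'(1,2)])
    then show "F.is_root p y" if "y \<in> orbit x"
      using that orb[OF x(1)] eval_conjugate[OF p'(1,3,4)] by (auto simp: F.is_root_def ev)
  qed
  have "algebraic_extension ?F K"
    using alg by (auto simp: algebraic_extension_def over_def)
  moreover have "normal_extension ?F K"
    unfolding normal_extension_def
  proof (intro conjI ballI impI)
    fix p assume p: "p \<in> carrier (K[X]\<^bsub>?F\<^esub>)" and "pirreducible\<^bsub>?F\<^esub> K p \<and> (\<exists>x. F.is_root p x)"
    then obtain x where px: "pirreducible\<^bsub>?F\<^esub> K p" "x \<in> \<Gamma>" "F.eval p x = \<zero>"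
      by (auto simp: F.is_root_def)
    have pF: "p \<in> carrier (poly_ring ?F)" using in_F p by (simp add: univ)
    have "F.roots p = mset_set (orbit x)"
      by (rule F.roots_eq_mset_set[OF pF orbit(1) conj_root[OF p px] deg[OF p px]])
    then show "F.splitted p"
      using F.size_roots_le_degree[OF pF] deg[OF p px] by (simp add: F.splitted_def)
  qed fact
  moreover have "separable_extension ?F K"
    unfolding separable_extension_def
  proof (intro conjI ballI)
    fix x z assume x: "x \<in> carrier ?F" and z: "z \<in> carrier F.alg_closure"
    interpret C: algebraic_closure F.alg_closure "F.indexed_const ` carrier ?F"
      by (rule F.alg_closureE(1))
    let ?h = "F.indexed_const" and ?p = "F.Irr K x"
    have x': "x \<in> \<Gamma>" using x by simp
    have h: "?h \<in> ring_hom ?F F.alg_closure" by (rule F.alg_closureE(2))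
    interpret h: ring_hom_ring ?F F.alg_closure ?h
      by (rule ring_hom_ringI2[OF F.ring_axioms C.ring_axioms h])
    have inj: "inj_on ?h S" for S
      by (rule inj_onI) (metis F.indexed_const_def)
    note p = F.IrrE[OF KF x alg[OF x']]
    have pF: "?p \<in> carrier (poly_ring ?F)" using in_F p(1) by (simp add: univ)
    have hp: "map ?h ?p \<in> carrier (poly_ring F.alg_closure)"
      by (rule polynomial_hom[OF h F.field_axioms C.field_axioms pF])
    have h0: "?h \<zero> = \<zero>\<^bsub>F.alg_closure\<^esub>" using h.hom_zero by simp
    have "?p \<noteq> []" by (rule F.pirreducibleE(1)[OF subfieldE(1)[OF KF] p(1,2)])
    have "C.is_root (map ?h ?p) (?h y)" if y: "y \<in> orbit x" for y
    proof -
      have "F.is_root ?p y" using conj_root[OF p(1,2) x' _ y] p(4) by simp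
      then have "y \<in> carrier ?F" "F.eval ?p y = \<zero>\<^bsub>?F\<^esub>" by (auto simp: F.is_root_def)
      then show ?thesis
        using h.eval_hom[OF F.carrier_is_subring _ pF, of y] \<open>?p \<noteq> []\<close> h.hom_closed[of y]
        by (simp add: C.is_root_def h0 del: F.eval_consistent)
    qed
    moreover have "degree (map ?h ?p) \<le> card (?h ` orbit x)"
      using deg[OF p(1,2) x'] p(4) by (simp add: card_image[OF inj])
    ultimately have "C.roots (map ?h ?p) = mset_set (?h ` orbit x)"
      using orbit(1) by (intro C.roots_eq_mset_set[OF hp]) auto
    then show "C.alg_mult (map ?h ?p) z \<le> 1"
      using orbit(1) by (simp add: C.alg_mult_eq_count_roots[OF hp] count_mset_set')
  qed fact
  ultimately have "galois_extension ?F K"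
    using KF F.field_axioms by (simp add: galois_extension_def)
  then show ?thesis using \<Gamma>' by (simp add: galois_subfields_def)
qed

text \<open>
  The minimal polynomial \<open>p\<close> of \<open>x\<close> over \<open>K\<close> splits over \<open>\<Gamma>\<close> and vanishes at \<open>y = g x\<close>.  The minimal
  polynomial of \<open>y\<close> over \<open>\<Gamma>\<close> divides \<open>p\<close>, so it has degree one and its root \<open>y\<close> is in \<open>\<Gamma>\<close>.
\<close>

lemma galois_imp_stable:
  assumes \<Gamma>: "\<Gamma> \<in> galois_subfields L K" and g: "g \<in> G" and x: "x \<in> \<Gamma>"
  shows "g x \<in> \<Gamma>"
proof -
  have "intermediate \<Gamma>" using \<Gamma> by (simp add: galois_subfields_def intermediate_def)
  note \<Gamma>' = intermediateD[OF this]
  let ?F = "L\<lparr>carrier := \<Gamma>\<rparr>"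
  interpret F: field ?F by (rule subfield_iff(2)[OF \<Gamma>'(1)])
  have KF: "subfield K ?F" and nrm: "normal_extension ?F K"
    using \<Gamma> by (auto simp: galois_subfields_def galois_extension_def)
  have univ: "univ_poly ?F = univ_poly L" by (rule univ_poly_consistent[OF \<Gamma>'(4)])
  have ev: "F.eval = eval" by (rule eval_consistent[OF \<Gamma>'(4)])
  have xF: "x \<in> carrier ?F" and xL: "x \<in> carrier L" using x \<Gamma>'(3) by auto
  have "(F.algebraic over K) x"
    using nrm xF by (auto simp: normal_extension_def algebraic_extension_def over_def)
  note p = F.IrrE[OF KF xF this]
  let ?p = "F.Irr K x"
  have p0: "?p \<noteq> []" by (rule F.pirreducibleE(1)[OF subfieldE(1)[OF KF] p(1,2)])
  have "F.is_root ?p x" using xF p0 p(4) by (simp add: F.is_root_def)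
  then have split: "F.splitted ?p" using nrm p(1,2) by (auto simp: normal_extension_def)
  have pK: "?p \<in> carrier (K[X])" using p(1) by (simp add: univ)
  have pF: "?p \<in> carrier (poly_ring ?F)"
    by (rule F.carrier_polynomial_shell[OF subfieldE(1)[OF KF] p(1)])
  define y where "y = g x"
  have yL: "y \<in> carrier L" unfolding y_def by (rule Gal_app[OF g xL])
  have py: "eval ?p y = \<zero>"
    unfolding y_def using eval_conjugate[OF pK xL _ g] p(4) by (simp add: ev)
  have y_alg: "(algebraic over \<Gamma>) y" by (rule algebraic_mono[OF \<Gamma>'(2) all_algebraic[OF yL]])
  note q = IrrE[OF \<Gamma>'(1) yL y_alg]
  let ?q = "Irr \<Gamma> y"
  have p\<Gamma>: "?p \<in> carrier (\<Gamma>[X])" using pF by (simp add: univ)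
  have "?q pdivides ?p" by (rule Irr_minimal[OF \<Gamma>'(1) yL y_alg p\<Gamma> py])
  then have "?q pdivides\<^bsub>?F\<^esub> ?p"
    using pdivides_iff_shell[OF \<Gamma>'(1) q(1) p\<Gamma>] by (simp add: pdivides_def univ)
  then have "degree ?q = 1"
    using F.splitted_imp_trivial_factors[OF pF p0 split, of ?q] q(1,2) by (simp add: univ)
  then obtain b where b: "?q = [\<one>, b]" using q(3) by (cases ?q; cases "tl ?q") auto
  then have "b \<in> \<Gamma>" using coeffs_subset[OF q(1)] by simp
  moreover have "y \<oplus> b = \<zero>" using q(4) b yL \<open>b \<in> \<Gamma>\<close> \<Gamma>'(3) by auto
  ultimately have "y = \<ominus> b" using yL \<Gamma>'(3) minus_equality by blast
  then show ?thesis using \<open>b \<in> \<Gamma>\<close> subringE(5)[OF \<Gamma>'(4)] by (simp add: y_def)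
qed

text \<open>
  For \<open>n \<in> N\<close>, \<open>n g = g (g\<^sup>-\<^sup>1 n g)\<close> and the second factor fixes \<open>x\<close>.
\<close>

lemma fixed_field_normal_stable:
  assumes N: "N \<in> normal_subgroups (Gal_group L K)" and g: "g \<in> G" and x: "x \<in> fixed_field L N"
  shows "g x \<in> fixed_field L N"
proof -
  let ?i = "inv\<^bsub>E\<^esub> g"
  have xL: "x \<in> carrier L" using x by (simp add: fixed_field_def)
  have i: "?i \<in> G" by (rule inv_E_Gal[OF g])
  have ii: "inv\<^bsub>E\<^esub> ?i = g"
    by (rule E.inv_char[OF Gal_in_E[OF i] Gal_in_E[OF g] inv_E_l[OF g] inv_E_r[OF g]])
  have "n (g x) = g x" if n: "n \<in> N" for n
  proof -
    have nG: "n \<in> G" and "?i \<otimes>\<^bsub>E\<^esub> n \<otimes>\<^bsub>E\<^esub> inv\<^bsub>E\<^esub> ?i \<in> N"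
      using N n i unfolding normal_subgroup_iff by blast+
    then have "(?i \<otimes>\<^bsub>E\<^esub> n \<otimes>\<^bsub>E\<^esub> g) x = x"
      using x unfolding ii fixed_field_def by blast
    then have "?i (n (g x)) = x" using xL Gal_app[OF g xL] by (simp add: E_ops)
    then show ?thesis using inv_E_app(2)[OF g Gal_app[OF nG Gal_app[OF g xL]]] by simp
  qed
  then show ?thesis using Gal_app[OF g xL] by (simp add: fixed_field_def)
qed

lemma galois_intermediate: "\<Gamma> \<in> galois_subfields L K \<Longrightarrow> intermediate \<Gamma>"
  by (simp add: galois_subfields_def intermediate_def)

lemma galois_centralizer_invariant:
  assumes "\<Gamma> \<in> galois_subfields L K"
  shows "centralizer E (lmult L ` \<Gamma>) \<in> invariant_subalgebras L K"
  using galois_imp_stable[OF assms] by (rule stable_imp_invariant[OF galois_intermediate[OF assms]])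

lemma galois_centralizer_Int_Gal:
  "\<Gamma> \<in> galois_subfields L K \<Longrightarrow> centralizer E (lmult L ` \<Gamma>) \<inter> G = Gal L \<Gamma>"
  by (rule centralizer_Int_Gal[OF intermediateD(3,2)[OF galois_intermediate]])

lemma galois_Gal_normal:
  "\<Gamma> \<in> galois_subfields L K \<Longrightarrow> Gal L \<Gamma> \<in> normal_subgroups (Gal_group L K)"
  using Int_Gal_normal[OF galois_centralizer_invariant] by (simp add: galois_centralizer_Int_Gal)

lemma normal_fixed_field:
  assumes N: "N \<in> normal_subgroups (Gal_group L K)"
  shows "fixed_field L N \<in> galois_subfields L K" "Gal L (fixed_field L N) = N"
proof -
  have NG: "N \<subseteq> G" using N unfolding normal_subgroup_iff by blast
  show "fixed_field L N \<in> galois_subfields L K"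
    using fixed_field_normal_stable[OF N] by (rule stable_imp_galois[OF fixed_field_intermediate[OF NG]])
  show "Gal L (fixed_field L N) = N"
    using N unfolding normal_subgroup_iff by (intro Gal_fixed_field) blast+
qed

lemma skew_normal:
  assumes "N \<in> normal_subgroups (Gal_group L K)"
  shows "skew L K N = centralizer E (lmult L ` fixed_field L N)"
  using centralizer_eq_skew[OF galois_intermediate[OF normal_fixed_field(1)[OF assms]]]
  by (simp add: normal_fixed_field(2)[OF assms])

end

section \<open>The Galois correspondence for Galois subfields\<close>

theorem theorem3p10:
  fixes L :: "('a, 'b) ring_scheme" and K :: "'a set"
  assumes "G_extension L K"
  shows
    "((\<forall>\<Gamma> \<in> galois_subfields L K.
         centralizer (End_alg L K) (lmult L ` \<Gamma>) = skew L K (Gal L \<Gamma>))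
      \<and> invariant_subalgebras L K
          = {centralizer (End_alg L K) (lmult L ` \<Gamma>) | \<Gamma>. \<Gamma> \<in> galois_subfields L K}
      \<and> invariant_subalgebras L K
          = {skew L K N | N. N \<in> normal_subgroups (Gal_group L K)}
      \<and> normal_subgroups (Gal_group L K) = {Gal L \<Gamma> | \<Gamma>. \<Gamma> \<in> galois_subfields L K})
     \<and>
     (bij_betw (\<lambda>\<Gamma>. centralizer (End_alg L K) (lmult L ` \<Gamma>))
        (galois_subfields L K) (invariant_subalgebras L K)
      \<and> (\<forall>A \<in> invariant_subalgebras L K.
           centralizer (End_alg L K) A = lmult L ` fixed_field L (A \<inter> Gal L K)
           \<and> fixed_field L (A \<inter> Gal L K) \<in> galois_subfields L K
           \<and> centralizer (End_alg L K) (lmult L ` fixed_field L (A \<inter> Gal L K)) = A)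
      \<and> (\<forall>\<Gamma> \<in> galois_subfields L K.
           fixed_field L (centralizer (End_alg L K) (lmult L ` \<Gamma>) \<inter> Gal L K) = \<Gamma>))
     \<and>
     ((\<forall>\<Gamma> \<in> galois_subfields L K. Gal L \<Gamma> = pointwise_stabilizer (Gal L K) \<Gamma>)
      \<and> bij_betw (Gal L) (galois_subfields L K) (normal_subgroups (Gal_group L K))
      \<and> (\<forall>N \<in> normal_subgroups (Gal_group L K).
           fixed_field L N \<in> galois_subfields L K \<and> Gal L (fixed_field L N) = N)
      \<and> (\<forall>\<Gamma> \<in> galois_subfields L K. fixed_field L (Gal L \<Gamma>) = \<Gamma>))"
proof -
  interpret G_generated_extension L K
    using assms
    by (simp add: G_extension_def G_generated_extension_def G_generated_extension_axioms_def
        finite_field_extension_def finite_field_extension_axioms_def)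
  let ?S = "galois_subfields L K" and ?A = "invariant_subalgebras L K"
    and ?N = "normal_subgroups (Gal_group L K)"
  let ?C = "\<lambda>\<Gamma>. centralizer E (lmult L ` \<Gamma>)" and ?F = "\<lambda>A. fixed_field L (A \<inter> G)"

  have C_skew: "?C \<Gamma> = skew L K (Gal L \<Gamma>)" if "\<Gamma> \<in> ?S" for \<Gamma>
    by (rule centralizer_eq_skew[OF galois_intermediate[OF that]])
  have F_galois: "?F A \<in> ?S" if "A \<in> ?A" for A
    by (rule normal_fixed_field(1)[OF Int_Gal_normal[OF that]])
  have C_F: "?C (?F A) = A" if "A \<in> ?A" for A
    by (rule double_centralizer[OF invariant_subalgebraD(1,2)[OF that]])
  have fix_Gal: "fixed_field L (Gal L \<Gamma>) = \<Gamma>" if "\<Gamma> \<in> ?S" for \<Gamma>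
    by (rule fixed_field_Gal[OF galois_intermediate[OF that]])
  have F_C: "?F (?C \<Gamma>) = \<Gamma>" if "\<Gamma> \<in> ?S" for \<Gamma>
    using fix_Gal[OF that] by (simp add: galois_centralizer_Int_Gal[OF that])

  have A_eq_C: "?A = {?C \<Gamma> | \<Gamma>. \<Gamma> \<in> ?S}"
  proof (intro equalityI subsetI)
    fix A assume "A \<in> ?A"
    then show "A \<in> {?C \<Gamma> | \<Gamma>. \<Gamma> \<in> ?S}" using F_galois C_F[symmetric] by blast
  qed (use galois_centralizer_invariant in blast)
  have A_eq_skew: "?A = {skew L K N | N. N \<in> ?N}"
  proof (intro equalityI subsetI)
    fix A assume A: "A \<in> ?A"
    then show "A \<in> {skew L K N | N. N \<in> ?N}"
      using subalgebra_eq_skew[OF invariant_subalgebraD(1,2)[OF A]] Int_Gal_normal[OF A] by blast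
  next
    fix A assume "A \<in> {skew L K N | N. N \<in> ?N}"
    then show "A \<in> ?A"
      using skew_normal galois_centralizer_invariant[OF normal_fixed_field(1)] by auto
  qed
  have N_eq_Gal: "?N = {Gal L \<Gamma> | \<Gamma>. \<Gamma> \<in> ?S}"
  proof (intro equalityI subsetI)
    fix N assume "N \<in> ?N"
    then show "N \<in> {Gal L \<Gamma> | \<Gamma>. \<Gamma> \<in> ?S}"
      using normal_fixed_field[of N] by blast
  qed (use galois_Gal_normal in blast)

  have bij_C: "bij_betw ?C ?S ?A"
    by (rule bij_betw_byWitness[where f' = ?F])
      (use F_C C_F galois_centralizer_invariant F_galois in auto)
  have bij_Gal: "bij_betw (Gal L) ?S ?N"
    by (rule bij_betw_byWitness[where f' = "fixed_field L"])
      (use fix_Gal normal_fixed_field galois_Gal_normal in auto)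
  have stab: "Gal L \<Gamma> = pointwise_stabilizer G \<Gamma>" if "\<Gamma> \<in> ?S" for \<Gamma>
    using intermediateD(2)[OF galois_intermediate[OF that]]
    by (auto simp: Gal_def pointwise_stabilizer_def)

  have C_A: "centralizer E A = lmult L ` ?F A" if "A \<in> ?A" for A
    by (rule centralizer_of_subalgebra[OF invariant_subalgebraD(1,2)[OF that]])

  show ?thesis
    by (intro conjI ballI;
        (rule A_eq_C A_eq_skew N_eq_Gal bij_C bij_Gal
          | erule C_skew C_A F_galois C_F F_C stab fix_Gal normal_fixed_field))
qed

end
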